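(* Let $\{C(t)\}_{t\ge 0}$ be a clock process satisfying the Clock Assumption (stated in the context) with parameters $\alpha>0$, $\beta\in\mathbb{R}$ and function $K$. Let $\{Z(t)\}_{t\ge0}$ be the stochastic process given by $Z(t)=B(C(t))$, where $B$ is a standard real-valued Brownian motion independent of $C$. Let $M(t):=\sup_{0\le s\le t}|Z(s)|$. Then, for any $m\in\mathbb{N}$, $0=t_0<t_1<\cdots<t_m<\infty$, and $0\le a_1<b_1\le a_2<b_2\le\cdots\le a_m<b_m$, $$\lim_{\varepsilon\downarrow 0}\varepsilon^{2\alpha/(1+\alpha)}|\log\varepsilon|^{\beta/(1+\alpha)}\log\mathbb{P}\left(\bigcap_{i=1}^m\{a_i\varepsilon\le M(t_i)\le b_i\varepsilon\}\right) = -2^{-\beta/(1+\alpha)}(1+\alpha)^{1+\beta/(1+\alpha)}\left(\frac{\pi^2}{8\alpha}\right)^{\alpha/(1+\alpha)}\sum_{i=1}^m\left(\frac{K(t_{i-1},t_i)}{b_i^{2\alpha}}\right)^{1/(1+\alpha)}.$$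
   Context: Clock Assumption: $\{C(t)\}_{t\ge0}$ is a continuous non-negative non-decreasing process with $C(0)=0$, and there exist $\alpha>0$, $\beta\in\mathbb{R}$, and a function $K$, defined on pairs $(s,t)$ with $0\le s<t$, taking values in $(0,\infty)$ and non-decreasing (in the sense that $K(s,t)\le K(s',t')$ whenever $s'\le s<t\le t'$), such that for any $m\in\mathbb{N}$, any decreasing sequence $\{d_i\}_{i=1}^m\subset(0,\infty)$, and any $0=t_0<t_1<\cdots<t_m$, $$\lim_{\varepsilon\downarrow0}\varepsilon^\alpha|\log\varepsilon|^\beta\log\mathbb{P}\left(\sum_{i=1}^m d_i\Delta_iC\le\varepsilon\right)=-\left(\sum_{i=1}^m\left(d_i^\alpha K(t_{i-1},t_i)\right)^{1/(1+\alpha)}\right)^{1+\alpha},$$ where $\Delta_iC=C(t_i)-C(t_{i-1})$. *)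

theory Defs
  imports "HOL-Probability.Probability"
begin

text \<open>Real-valued processes are functions \<open>X :: real \<Rightarrow> 'a \<Rightarrow> real\<close> with the time first; only
  their values at times \<open>t \<ge> 0\<close> are constrained.  Path properties hold for every sample point.\<close>

definition (in prob_space) independent_processes ::
    "(real \<Rightarrow> 'a \<Rightarrow> real) \<Rightarrow> (real \<Rightarrow> 'a \<Rightarrow> real) \<Rightarrow> bool" where
  "independent_processes X Y \<longleftrightarrow>
     indep_var (PiM {0..} (\<lambda>_. borel)) (\<lambda>\<omega>. \<lambda>t\<in>{0..}. X t \<omega>)
               (PiM {0..} (\<lambda>_. borel)) (\<lambda>\<omega>. \<lambda>t\<in>{0..}. Y t \<omega>)"

definition (in prob_space) standard_brownian_motion :: "(real \<Rightarrow> 'a \<Rightarrow> real) \<Rightarrow> bool" where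
  "standard_brownian_motion B \<longleftrightarrow>
     (\<forall>t\<ge>0. random_variable borel (B t)) \<and>
     (AE \<omega> in M. B 0 \<omega> = 0) \<and>
     (\<forall>\<omega>\<in>space M. continuous_on {0..} (\<lambda>t. B t \<omega>)) \<and>
     (\<forall>n (s :: nat \<Rightarrow> real). 0 \<le> s 0 \<and> (\<forall>i<n. s i < s (Suc i)) \<longrightarrow>
        indep_vars (\<lambda>_. borel) (\<lambda>i \<omega>. B (s (Suc i)) \<omega> - B (s i) \<omega>) {..<n}) \<and>
     (\<forall>s t. 0 \<le> s \<and> s < t \<longrightarrow>
        distributed M lborel (\<lambda>\<omega>. B t \<omega> - B s \<omega>) (normal_density 0 (sqrt (t - s))))"

definition (in prob_space) clock_process :: "(real \<Rightarrow> 'a \<Rightarrow> real) \<Rightarrow> bool" where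
  "clock_process C \<longleftrightarrow>
     (\<forall>t\<ge>0. random_variable borel (C t)) \<and>
     (\<forall>\<omega>\<in>space M. C 0 \<omega> = 0 \<and> (\<forall>t\<ge>0. 0 \<le> C t \<omega>) \<and>
        mono_on {0..} (\<lambda>t. C t \<omega>) \<and> continuous_on {0..} (\<lambda>t. C t \<omega>))"

text \<open>The limit on the right-hand side below is nonzero for \<open>m \<ge> 1\<close>, so the convention
  \<open>ln 0 = 0\<close> plays no role: the assumed convergence forces the probabilities to be positive for
  all small \<open>\<epsilon>\<close>.\<close>

definition (in prob_space) clock_assumption ::
    "(real \<Rightarrow> 'a \<Rightarrow> real) \<Rightarrow> real \<Rightarrow> real \<Rightarrow> (real \<Rightarrow> real \<Rightarrow> real) \<Rightarrow> bool" where
  "clock_assumption C \<alpha> \<beta> K \<longleftrightarrow>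
     clock_process C \<and> \<alpha> > 0 \<and>
     (\<forall>s t. 0 \<le> s \<and> s < t \<longrightarrow> K s t > 0) \<and>
     (\<forall>s' s t t'. 0 \<le> s' \<and> s' \<le> s \<and> s < t \<and> t \<le> t' \<longrightarrow> K s t \<le> K s' t') \<and>
     (\<forall>(m::nat) (d :: nat \<Rightarrow> real) (t :: nat \<Rightarrow> real).
        m \<ge> 1 \<and> (\<forall>i\<in>{1..m}. d i > 0) \<and> (\<forall>i\<in>{1..<m}. d (Suc i) < d i) \<and>
        t 0 = 0 \<and> (\<forall>i<m. t i < t (Suc i)) \<longrightarrow>
        ((\<lambda>\<epsilon>. \<epsilon> powr \<alpha> * \<bar>ln \<epsilon>\<bar> powr \<beta> *
            ln (prob {\<omega>\<in>space M. (\<Sum>i=1..m. d i * (C (t i) \<omega> - C (t (i - 1)) \<omega>)) \<le> \<epsilon>}))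
          \<longlongrightarrow> - ((\<Sum>i=1..m. (d i powr \<alpha> * K (t (i - 1)) (t i)) powr (1 / (1 + \<alpha>))) powr (1 + \<alpha>)))
          (at_right 0))"

definition time_changed ::
    "(real \<Rightarrow> 'a \<Rightarrow> real) \<Rightarrow> (real \<Rightarrow> 'a \<Rightarrow> real) \<Rightarrow> real \<Rightarrow> 'a \<Rightarrow> real" where
  "time_changed B C t \<omega> = B (C t \<omega>) \<omega>"

definition running_max :: "(real \<Rightarrow> 'a \<Rightarrow> real) \<Rightarrow> real \<Rightarrow> 'a \<Rightarrow> real" where
  "running_max Z t \<omega> = (SUP s\<in>{0..t}. \<bar>Z s \<omega>\<bar>)"

end

theory Submission
  imports Defs "HOL-Real_Asymp.Real_Asymp"
begin

text \<open>
  The clock starts at 0 and is continuous and non-decreasing, so \<open>M(t)\<close> is the maximum of \<open>\<bar>B\<bar>\<close> on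
  \<open>[0, C(t)]\<close>.  Conditionally on the clock, the event that \<open>M(t\<^sub>i) \<le> b\<^sub>i \<epsilon>\<close> for all \<open>i\<close> says that Brownian
  motion stays in a tube whose half-width is \<open>b\<^sub>i \<epsilon>\<close> during the time interval \<open>(C(t\<^sub>i\<^sub>-\<^sub>1), C(t\<^sub>i)]\<close>.
  On an interval of half-width \<open>r\<close> the leading Dirichlet eigenfunction is \<open>cos (\<pi> x / 2r)\<close>, with decay
  rate \<open>\<pi>\<^sup>2 / 8r\<^sup>2\<close>; hence the conditional probability is, up to a constant factor and an arbitrarily small
  relative error in the exponent, \<open>exp (- \<pi>\<^sup>2 / (8 \<epsilon>\<^sup>2) X)\<close> with \<open>X = \<Sum> b\<^sub>i\<^sup>-\<^sup>2 (C(t\<^sub>i) - C(t\<^sub>i\<^sub>-\<^sub>1))\<close>.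

  These two bounds avoid stopping times.  They are proved for Gaussian random walks
  (\<open>tube_prob_lower\<close>, \<open>tube_prob_upper\<close>) by pushing a cosine through one step at a time, and are then
  carried over to Brownian motion by sampling it at dyadic times
  (\<open>dyadic_event_lower\<close>, \<open>dyadic_event_upper\<close>).  The lower bound is exact for the cosine that vanishes on the
  boundary of the tube, and it survives a change of stage because the tube widens.  The upper bound uses
  a slightly wider cosine, which is bounded below on the tube; the chance that one small step reaches
  its zero is of smaller order than the length of the step.  Independence and Fubini's theorem turn both bounds
  into bounds by Laplace transforms of \<open>X\<close> (\<open>small_max_event_lower\<close>, \<open>small_max_event_upper\<close>).

  The clock assumption gives the decay of \<open>\<P>(X \<le> s)\<close> as \<open>s \<rightarrow> 0\<close>, since the weights \<open>b\<^sub>i\<^sup>-\<^sup>2\<close> decrease.  The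
  Laplace transform is evaluated by Laplace's principle: with \<open>L(\<epsilon>)\<close> the speed of the theorem and
  \<open>x(\<epsilon>) = \<epsilon>\<^sup>2 L(\<epsilon>)\<close>, the variable \<open>X / x(\<epsilon>)\<close> satisfies a large deviation bound with rate \<open>k y\<^sup>-\<^sup>\<alpha>\<close>, and
  \<open>log \<E> exp (- \<gamma> X / \<epsilon>\<^sup>2) \<sim> - L(\<epsilon>) min\<^sub>y (\<gamma> y + k y\<^sup>-\<^sup>\<alpha>)\<close> (\<open>laplace_transform_log_rate\<close>).

  Finally, the lower constraints \<open>a\<^sub>i \<epsilon> \<le> M(t\<^sub>i)\<close> cost nothing on this scale.  If one of them fails, then
  \<open>M(t\<^sub>i) \<le> c\<^sub>i \<epsilon>\<close> with \<open>c\<^sub>i = (a\<^sub>i + b\<^sub>i) / 2 < b\<^sub>i\<close>, and replacing \<open>b\<^sub>i\<close> by \<open>c\<^sub>i\<close> keeps the sequence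
  increasing but strictly raises the rate, so these events are exponentially negligible.
\<close>

section \<open>Cosines under one Gaussian step\<close>

lemma std_normal_cos_integral:
  "(\<integral>z. cos (\<theta> * (x + \<sigma> * z)) \<partial>std_normal_distribution) = exp (- (\<theta> * \<sigma>)\<^sup>2 / 2) * cos (\<theta> * x)"
proof -
  let ?N = "std_normal_distribution"
  interpret real_distribution ?N by (rule real_dist_normal_dist)
  have ch: "(CLINT z|?N. iexp (\<theta> * \<sigma> * z)) = complex_of_real (exp (- (\<theta> * \<sigma>)\<^sup>2 / 2))"
    using char_std_normal_distribution unfolding char_def by metis
  have int: "complex_integrable ?N (\<lambda>z. iexp (\<theta> * \<sigma> * z))"
    by (rule integrable_iexp) auto
  have c: "(\<integral>z. cos (\<theta> * \<sigma> * z) \<partial>?N) = exp (- (\<theta> * \<sigma>)\<^sup>2 / 2)"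
    using integral_Re[OF int] ch by (simp add: Re_exp)
  have s: "(\<integral>z. sin (\<theta> * \<sigma> * z) \<partial>?N) = 0"
    using integral_Im[OF int] ch by (simp add: Im_exp)
  have ic: "integrable ?N (\<lambda>z. cos (\<theta> * \<sigma> * z))" and isn: "integrable ?N (\<lambda>z. sin (\<theta> * \<sigma> * z))"
    by (rule integrable_const_bound[where B=1]; auto)+
  have "(\<integral>z. cos (\<theta> * (x + \<sigma> * z)) \<partial>?N)
      = (\<integral>z. cos (\<theta> * x) * cos (\<theta> * \<sigma> * z) - sin (\<theta> * x) * sin (\<theta> * \<sigma> * z) \<partial>?N)"
    by (simp add: cos_add distrib_left mult.assoc)
  also have "\<dots> = cos (\<theta> * x) * (\<integral>z. cos (\<theta> * \<sigma> * z) \<partial>?N) - sin (\<theta> * x) * (\<integral>z. sin (\<theta> * \<sigma> * z) \<partial>?N)"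
    using ic isn by simp
  finally show ?thesis using c s by simp
qed

text \<open>Each negative arch of the sine is the positive arch before it shifted by half a period, and there the
  weight \<open>f\<close> is smaller.\<close>

lemma integral_decreasing_times_sin_nonneg:
  fixes f :: "real \<Rightarrow> real"
  assumes "\<theta> > 0" and int: "integrable lborel f" and nonneg: "\<And>u. 0 \<le> f u"
    and dec: "\<And>u v. 0 \<le> u \<Longrightarrow> u \<le> v \<Longrightarrow> f v \<le> f u"
  shows "0 \<le> (\<integral>u. indicator {0..} u * (f u * sin (\<theta> * u)) \<partial>lborel)"
proof -
  define \<tau> where "\<tau> = pi / \<theta>"
  have [measurable]: "f \<in> borel_measurable borel" using int by auto
  have bnd: "integrable lborel (\<lambda>u. indicator {0..} u * (f u * h u))"
    if [measurable]: "h \<in> borel_measurable borel" and "\<And>u. \<bar>h u\<bar> \<le> 1" for h :: "real \<Rightarrow> real"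
  proof (rule Bochner_Integration.integrable_bound[OF int])
    show "AE u in lborel. norm (indicator {0..} u * (f u * h u)) \<le> norm (f u)"
      using that(2) mult_left_mono[OF that(2) nonneg] nonneg by (auto simp: indicator_def abs_mult)
  qed auto
  let ?p = "\<lambda>u. max 0 (sin (\<theta> * u))" and ?n = "\<lambda>u. max 0 (- sin (\<theta> * u))"
  have bp: "\<bar>?p u\<bar> \<le> 1" and bn: "\<bar>?n u\<bar> \<le> 1" for u
    using sin_le_one[of "\<theta>*u"] sin_ge_minus_one[of "\<theta>*u"] by (auto simp: max_def)
  have ip: "integrable lborel (\<lambda>u. indicator {0..} u * (f u * ?p u))"
    by (rule bnd) (use bp in auto)
  have "in": "integrable lborel (\<lambda>u. indicator {0..} u * (f u * ?n u))"
    by (rule bnd) (use bn in auto)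
  have shift: "indicator {0..} (\<tau> + 1 * u) * (f (\<tau> + 1 * u) * ?n (\<tau> + 1 * u))
      = indicator {0..} u * (f (\<tau> + u) * ?p u)" for u
  proof -
    have s: "sin (\<theta> * (\<tau> + u)) = - sin (\<theta> * u)"
      using \<open>\<theta> > 0\<close> by (simp add: \<tau>_def distrib_left sin_add)
    have "sin (\<theta> * u) \<le> 0" if "u < 0" "0 \<le> \<tau> + u"
    proof -
      have "0 \<le> sin (\<theta> * (\<tau> + u))"
        using that \<open>\<theta> > 0\<close> mult_pos_neg[of \<theta> u]
        by (intro sin_ge_zero mult_nonneg_nonneg) (simp_all add: \<tau>_def distrib_left)
      then show ?thesis using s by simp
    qed
    moreover have "0 < \<tau>" using \<open>\<theta> > 0\<close> by (simp add: \<tau>_def)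
    ultimately show ?thesis using s by (auto simp: indicator_def max_def)
  qed
  have i2: "integrable lborel (\<lambda>u. indicator {0..} u * (f (\<tau> + u) * ?p u))"
    using lborel_integrable_real_affine[OF "in", of 1 \<tau>] unfolding shift by simp
  have "(\<integral>u. indicator {0..} u * (f u * ?n u) \<partial>lborel) = (\<integral>u. indicator {0..} u * (f (\<tau> + u) * ?p u) \<partial>lborel)"
    using lborel_integral_real_affine[of 1 "\<lambda>u. indicator {0..} u * (f u * ?n u)" \<tau>] unfolding shift by simp
  also have "\<dots> \<le> (\<integral>u. indicator {0..} u * (f u * ?p u) \<partial>lborel)"
    using \<open>\<theta> > 0\<close> by (intro integral_mono i2 ip)
      (auto simp: indicator_def \<tau>_def intro!: mult_right_mono dec)
  finally have "0 \<le> (\<integral>u. indicator {0..} u * (f u * ?p u) \<partial>lborel) - (\<integral>u. indicator {0..} u * (f u * ?n u) \<partial>lborel)"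
    by simp
  also have "\<dots> = (\<integral>u. indicator {0..} u * (f u * ?p u) - indicator {0..} u * (f u * ?n u) \<partial>lborel)"
    using ip "in" by simp
  also have "(\<lambda>u. indicator {0..} u * (f u * ?p u) - indicator {0..} u * (f u * ?n u))
      = (\<lambda>u. indicator {0..} u * (f u * sin (\<theta> * u)))"
    by (auto simp: max_def algebra_simps indicator_def)
  finally show ?thesis .
qed

text \<open>Beyond the zero \<open>w\<close> the cosine continues as minus a sine, while the Gaussian density around
  \<open>x \<le> w\<close> decreases there.\<close>

lemma std_normal_cos_beyond_le_0:
  assumes "0 < w" "0 < \<sigma>" "x \<le> w"
  shows "(\<integral>z. indicator {z. w \<le> x + \<sigma> * z} z * cos (pi / (2 * w) * (x + \<sigma> * z)) \<partial>std_normal_distribution) \<le> 0"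
proof -
  define a where "a = (w - x) / \<sigma>"
  have "a \<ge> 0" using assms by (simp add: a_def)
  have xa: "x + \<sigma> * (a + v) = w + \<sigma> * v" for v using assms by (simp add: a_def field_simps)
  let ?g = "\<lambda>z. std_normal_density z * (indicator {z. w \<le> x + \<sigma> * z} z * cos (pi / (2 * w) * (x + \<sigma> * z)))"
  have "(\<integral>z. indicator {z. w \<le> x + \<sigma> * z} z * cos (pi / (2 * w) * (x + \<sigma> * z)) \<partial>std_normal_distribution)
     = (\<integral>z. ?g z \<partial>lborel)"
    by (subst integral_density) auto
  also have "\<dots> = (\<integral>v. ?g (a + 1 * v) \<partial>lborel)"
    by (subst lborel_integral_real_affine[of 1 _ a]) auto
  also have "(\<lambda>v. ?g (a + 1 * v)) = (\<lambda>v. - (indicator {0..} v * (std_normal_density (a + v) * sin ((pi * \<sigma> / (2 * w)) * v))))"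
  proof
    fix v
    have "cos (pi / (2 * w) * (w + \<sigma> * v)) = - sin ((pi * \<sigma> / (2 * w)) * v)"
      using assms by (simp add: distrib_left cos_add mult.assoc)
    then show "?g (a + 1 * v) = - (indicator {0..} v * (std_normal_density (a + v) * sin ((pi * \<sigma> / (2 * w)) * v)))"
      using assms by (auto simp: xa indicator_def zero_le_mult_iff)
  qed
  also have "(\<integral>v. - (indicator {0..} v * (std_normal_density (a + v) * sin ((pi * \<sigma> / (2 * w)) * v))) \<partial>lborel) \<le> 0"
  proof -
    have "0 \<le> (\<integral>v. indicator {0..} v * (std_normal_density (a + v) * sin ((pi * \<sigma> / (2 * w)) * v)) \<partial>lborel)"
    proof (rule integral_decreasing_times_sin_nonneg)
      show "0 < pi * \<sigma> / (2 * w)" using assms by simp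
      have "integrable lborel std_normal_density" using integrable_normal_density[of 1 0] by simp
      from lborel_integrable_real_affine[OF this, of 1 a]
      show "integrable lborel (\<lambda>v. std_normal_density (a + v))" by simp
      show "std_normal_density (a + v) \<le> std_normal_density (a + u)" if "0 \<le> u" "u \<le> v" for u v
        using that \<open>a \<ge> 0\<close> by (auto simp: std_normal_density_def intro!: divide_right_mono power_mono)
    qed auto
    then show ?thesis by simp
  qed
  finally show ?thesis .
qed

text \<open>Killing the walk outside \<open>[- w, w]\<close> can only increase the integral of the cosine with zeros at \<open>\<plusminus> w\<close>,
  because the discarded contributions on both sides are nonpositive.  So the killed step still has the cosine
  as a subsolution, with the eigenvalue of the free step.\<close>

lemma std_normal_cos_step_lower:
  assumes "0 < w" "0 < \<sigma>" "\<bar>x\<bar> \<le> w"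
  shows "exp (- (pi / (2 * w) * \<sigma>)\<^sup>2 / 2) * cos (pi / (2 * w) * x)
    \<le> (\<integral>z. indicator {z. \<bar>x + \<sigma> * z\<bar> \<le> w} z * cos (pi / (2 * w) * (x + \<sigma> * z)) \<partial>std_normal_distribution)"
proof -
  let ?N = "std_normal_distribution" and ?c = "\<lambda>x z. cos (pi / (2 * w) * (x + \<sigma> * z))"
  interpret real_distribution ?N by (rule real_dist_normal_dist)
  have [simp]: "integrable ?N (\<lambda>z. ?c x z)" for x
    by (rule integrable_const_bound[where B=1]) auto
  have int[simp]: "integrable ?N (\<lambda>z. indicator A z * ?c x z)" if "A \<in> sets borel" for A x
    by (rule integrable_const_bound[where B=1]) (use that in \<open>auto simp: indicator_def\<close>)
  \<comment> \<open>The substitution of \<open>- z\<close> for \<open>z\<close> maps one side of the exterior to the other.\<close>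
  have refl: "(\<integral>z. indicator {z. w \<le> - x + \<sigma> * z} z * ?c (-x) z \<partial>?N)
     = (\<integral>z. indicator {z. x + \<sigma> * z \<le> - w} z * ?c x z \<partial>?N)"
  proof -
    have "(\<integral>z. indicator {z. w \<le> - x + \<sigma> * z} z * ?c (-x) z \<partial>?N)
      = (\<integral>z. std_normal_density z * (indicator {z. w \<le> - x + \<sigma> * z} z * ?c (-x) z) \<partial>lborel)"
      by (subst integral_density) auto
    also have "\<dots> = (\<integral>z. std_normal_density (0 + (-1) * z) * (indicator {z. w \<le> - x + \<sigma> * z} (0 + (-1) * z) * ?c (-x) (0 + (-1) * z)) \<partial>lborel)"
      by (subst lborel_integral_real_affine[of "-1" _ 0]) auto
    also have "\<dots> = (\<integral>z. std_normal_density z * (indicator {z. x + \<sigma> * z \<le> - w} z * ?c x z) \<partial>lborel)"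
    proof (rule Bochner_Integration.integral_cong[OF refl])
      fix z
      have "?c (-x) (-z) = ?c x z"
        using cos_minus[of "pi / (2 * w) * (x + \<sigma> * z)"] by (simp only: mult_minus_right[symmetric]) simp
      then show "std_normal_density (0 + (-1) * z) * (indicator {z. w \<le> - x + \<sigma> * z} (0 + (-1) * z) * ?c (-x) (0 + (-1) * z))
         = std_normal_density z * (indicator {z. x + \<sigma> * z \<le> - w} z * ?c x z)"
        by (auto simp: indicator_def std_normal_density_def)
    qed
    also have "\<dots> = (\<integral>z. indicator {z. x + \<sigma> * z \<le> - w} z * ?c x z \<partial>?N)"
      by (subst integral_density) auto
    finally show ?thesis .
  qed
  have out: "(\<integral>z. indicator {z. w \<le> y + \<sigma> * z} z * ?c y z \<partial>?N) \<le> 0" if "y \<le> w" for y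
    using std_normal_cos_beyond_le_0 assms that by blast
  have i1: "integrable ?N (\<lambda>z. indicator {z. \<bar>x + \<sigma> * z\<bar> \<le> w} z * ?c x z)"
    and i2: "integrable ?N (\<lambda>z. indicator {z. w \<le> x + \<sigma> * z} z * ?c x z)"
    and i3: "integrable ?N (\<lambda>z. indicator {z. x + \<sigma> * z \<le> - w} z * ?c x z)"
    by (rule int; measurable)+
  have "exp (- (pi / (2 * w) * \<sigma>)\<^sup>2 / 2) * cos (pi / (2 * w) * x) = (\<integral>z. ?c x z \<partial>?N)"
    by (simp only: std_normal_cos_integral)
  also have "\<dots> = (\<integral>z. indicator {z. \<bar>x + \<sigma> * z\<bar> \<le> w} z * ?c x z + (indicator {z. w \<le> x + \<sigma> * z} z * ?c x z
       + indicator {z. x + \<sigma> * z \<le> - w} z * ?c x z) \<partial>?N)"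
  proof (rule Bochner_Integration.integral_cong[OF HOL.refl])
    fix z
    have "?c x z = 0" if "x + \<sigma> * z = w \<or> x + \<sigma> * z = - w"
    proof -
      have "pi / (2 * w) * w = pi / 2" using assms by simp
      then show ?thesis using that by (metis cos_pi_half cos_minus mult_minus_right)
    qed
    then show "?c x z = indicator {z. \<bar>x + \<sigma> * z\<bar> \<le> w} z * ?c x z + (indicator {z. w \<le> x + \<sigma> * z} z * ?c x z
       + indicator {z. x + \<sigma> * z \<le> - w} z * ?c x z)"
      using assms by (cases "x + \<sigma> * z = w \<or> x + \<sigma> * z = - w") (auto simp: indicator_def)
  qed
  also have "\<dots> = (\<integral>z. indicator {z. \<bar>x + \<sigma> * z\<bar> \<le> w} z * ?c x z \<partial>?N) + ((\<integral>z. indicator {z. w \<le> x + \<sigma> * z} z * ?c x z \<partial>?N)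
       + (\<integral>z. indicator {z. x + \<sigma> * z \<le> - w} z * ?c x z \<partial>?N))"
    by (simp only: Bochner_Integration.integral_add[OF i1 Bochner_Integration.integrable_add[OF i2 i3]]
          Bochner_Integration.integral_add[OF i2 i3])
  also have "\<dots> \<le> (\<integral>z. indicator {z. \<bar>x + \<sigma> * z\<bar> \<le> w} z * ?c x z \<partial>?N) + 0"
  proof -
    have "(\<integral>z. indicator {z. w \<le> x + \<sigma> * z} z * ?c x z \<partial>?N) \<le> 0"
      by (rule out) (use assms in auto)
    moreover have "(\<integral>z. indicator {z. x + \<sigma> * z \<le> - w} z * ?c x z \<partial>?N) \<le> 0"
      unfolding refl[symmetric] by (rule out) (use assms in auto)
    ultimately show ?thesis by linarith
  qed
  finally show ?thesis by simp
qed

text \<open>The zeros \<open>\<plusminus> \<pi> / (2\<theta>)\<close> of the cosine lie at distance \<open>\<rho>\<close> outside the interval \<open>[- r, r]\<close>.  The cosine is negative only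
  beyond them, so discarding the exterior costs at most \<open>\<P>(\<bar>\<sigma> z\<bar> \<ge> \<rho>)\<close>, which the fourth moment
  bounds by \<open>3 (\<sigma> / \<rho>)\<^sup>4\<close>.  Since \<open>\<sigma>\<^sup>2\<close> is the time step, these errors vanish when summed over a fine
  grid.\<close>

lemma std_normal_cos_step_upper:
  assumes "0 < r" "0 < \<theta>" "r < pi / (2 * \<theta>)" "\<bar>x\<bar> \<le> r" "\<rho> = pi / (2 * \<theta>) - r"
  shows "(\<integral>z. indicator {z. \<bar>x + \<sigma> * z\<bar> \<le> r} z * cos (\<theta> * (x + \<sigma> * z)) \<partial>std_normal_distribution)
    \<le> exp (- (\<theta> * \<sigma>)\<^sup>2 / 2) * cos (\<theta> * x) + 3 * (\<sigma> / \<rho>) ^ 4"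
proof -
  let ?N = "std_normal_distribution" and ?c = "\<lambda>z. cos (\<theta> * (x + \<sigma> * z))"
  interpret real_distribution ?N by (rule real_dist_normal_dist)
  have ic[simp]: "integrable ?N ?c"
    by (rule integrable_const_bound[where B=1]) auto
  have ii: "integrable ?N (\<lambda>z. indicator {z. \<bar>x + \<sigma> * z\<bar> \<le> r} z * ?c z)"
    by (rule integrable_const_bound[where B=1]) (auto simp: indicator_def)
  have m4: "has_bochner_integral lborel (\<lambda>z. std_normal_density z * z ^ 4) 3"
    using std_normal_moment_even[of 2] by (simp add: fact_numeral)
  then have i4: "integrable ?N (\<lambda>z. z ^ 4)"
    by (subst integrable_density) (auto simp: has_bochner_integral_iff)
  have e4: "(\<integral>z. z ^ 4 \<partial>?N) = 3"
    using m4 by (subst integral_density) (auto simp: has_bochner_integral_iff)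
  have "\<rho> > 0" using assms by simp
  have "(\<integral>z. indicator {z. \<bar>x + \<sigma> * z\<bar> \<le> r} z * ?c z \<partial>?N) \<le> (\<integral>z. ?c z + (\<sigma> / \<rho>) ^ 4 * z ^ 4 \<partial>?N)"
  proof (rule integral_mono[OF ii])
    show "integrable ?N (\<lambda>z. ?c z + (\<sigma> / \<rho>) ^ 4 * z ^ 4)" using i4 by simp
    fix z
    have q: "0 \<le> (\<sigma> / \<rho>) ^ 4 * z ^ 4" by simp
    show "indicator {z. \<bar>x + \<sigma> * z\<bar> \<le> r} z * ?c z \<le> ?c z + (\<sigma> / \<rho>) ^ 4 * z ^ 4"
    proof (cases "\<bar>x + \<sigma> * z\<bar> \<le> pi / (2 * \<theta>)")
      case True
      then have "\<bar>\<theta> * (x + \<sigma> * z)\<bar> \<le> pi / 2" using assms by (simp add: abs_mult pos_le_divide_eq mult_ac)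
      then have "0 \<le> ?c z" by (intro cos_ge_zero) auto
      then show ?thesis using q by (auto simp: indicator_def)
    next
      case False
      then have "\<rho> \<le> \<bar>\<sigma> * z\<bar>" using assms by auto
      then have "1 \<le> \<bar>\<sigma> / \<rho> * z\<bar>" using \<open>\<rho> > 0\<close> by (simp add: abs_mult field_simps)
      then have "1 \<le> \<bar>\<sigma> / \<rho> * z\<bar> ^ 4" by (rule one_le_power)
      then have "1 \<le> (\<sigma> / \<rho>) ^ 4 * z ^ 4" by (simp add: power_even_abs_numeral power_mult_distrib power_divide)
      then show ?thesis using False assms cos_ge_minus_one[of "\<theta> * (x + \<sigma> * z)"]
        by (auto simp: indicator_def simp del: cos_ge_minus_one)
    qed
  qed
  also have "\<dots> = exp (- (\<theta> * \<sigma>)\<^sup>2 / 2) * cos (\<theta> * x) + 3 * (\<sigma> / \<rho>) ^ 4"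
    using i4 e4 by (simp add: std_normal_cos_integral)
  finally show ?thesis .
qed

section \<open>Gaussian walks in a widening tube\<close>

text \<open>Fubini's theorem for independent variables, with the second one resampled.\<close>

lemma (in prob_space) indep_var_nn_integral:
  assumes "indep_var S X T Y" and [measurable]: "G \<in> borel_measurable (S \<Otimes>\<^sub>M T)"
  shows "(\<integral>\<^sup>+\<omega>. G (X \<omega>, Y \<omega>) \<partial>M) = (\<integral>\<^sup>+\<omega>. (\<integral>\<^sup>+\<omega>'. G (X \<omega>, Y \<omega>') \<partial>M) \<partial>M)"
proof -
  have [measurable]: "X \<in> measurable M S" "Y \<in> measurable M T"
    using assms(1) by (auto simp: indep_var_distribution_eq)
  interpret Y: prob_space "distr M T Y" by (rule prob_space_distr) simp
  have [measurable]: "G \<in> borel_measurable (S \<Otimes>\<^sub>M distr M T Y)"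
    using assms(2) by (simp cong: measurable_cong_sets)
  have "(\<integral>\<^sup>+\<omega>. G (X \<omega>, Y \<omega>) \<partial>M) = (\<integral>\<^sup>+p. G p \<partial>distr M (S \<Otimes>\<^sub>M T) (\<lambda>\<omega>. (X \<omega>, Y \<omega>)))"
    by (simp add: nn_integral_distr)
  also have "\<dots> = (\<integral>\<^sup>+p. G p \<partial>(distr M S X \<Otimes>\<^sub>M distr M T Y))"
    using assms(1) by (simp add: indep_var_distribution_eq)
  also have "\<dots> = (\<integral>\<^sup>+x. (\<integral>\<^sup>+y. G (x, y) \<partial>distr M T Y) \<partial>distr M S X)"
    by (subst Y.nn_integral_fst[symmetric]) (simp_all cong: measurable_cong_sets)
  also have "\<dots> = (\<integral>\<^sup>+\<omega>. (\<integral>\<^sup>+y. G (X \<omega>, y) \<partial>distr M T Y) \<partial>M)"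
    by (subst nn_integral_distr) simp_all
  also have "\<dots> = (\<integral>\<^sup>+\<omega>. (\<integral>\<^sup>+\<omega>'. G (X \<omega>, Y \<omega>') \<partial>M) \<partial>M)"
    by (intro nn_integral_cong nn_integral_distr) measurable
  finally show ?thesis .
qed

text \<open>The increments \<open>X\<close> are normalised and the scale \<open>\<sigma>\<close> is kept apart, so that all integrals are against
  the standard normal distribution.\<close>

locale gaussian_walk = prob_space +
  fixes X :: "nat \<Rightarrow> 'a \<Rightarrow> real" and n :: nat and \<sigma> :: real
  assumes indep: "indep_vars (\<lambda>_. borel) X {..<n}"
    and std_normal: "i < n \<Longrightarrow> distr M borel (X i) = std_normal_distribution"
    and \<sigma>_pos: "0 < \<sigma>"
begin

definition S :: "nat \<Rightarrow> 'a \<Rightarrow> real" where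
  "S k \<omega> = \<sigma> * (\<Sum>i<k. X i \<omega>)"

definition tube :: "(nat \<Rightarrow> real) \<Rightarrow> nat \<Rightarrow> 'a set" where
  "tube r k = {\<omega>\<in>space M. \<forall>j\<le>k. \<bar>S j \<omega>\<bar> \<le> r j}"

lemma S_0 [simp]: "S 0 \<omega> = 0"
  by (simp add: S_def)

lemma S_Suc: "S (Suc k) \<omega> = S k \<omega> + \<sigma> * X k \<omega>"
  by (simp add: S_def distrib_left)

lemma X_measurable [measurable]: "i < n \<Longrightarrow> X i \<in> borel_measurable M"
  using indep by (auto simp: indep_vars_def)

lemma S_measurable: "k \<le> n \<Longrightarrow> S k \<in> borel_measurable M"
  unfolding S_def by (intro borel_measurable_times borel_measurable_const borel_measurable_sum) auto

lemma tube_sets: "k \<le> n \<Longrightarrow> tube r k \<in> sets M"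
proof -
  assume "k \<le> n"
  then have [measurable]: "S j \<in> borel_measurable M" if "j \<in> {..k}" for j
    using that by (intro S_measurable) auto
  have "tube r k = {\<omega>\<in>space M. \<forall>j\<in>{..k}. \<bar>S j \<omega>\<bar> \<le> r j}" by (auto simp: tube_def)
  also have "\<dots> \<in> sets M" by (rule sets.sets_Collect_finite_All) auto
  finally show ?thesis .
qed

text \<open>The Markov property at time \<open>k\<close>: the next increment is independent of the path up to \<open>k\<close>, which is
  all that the tube event and the current position depend on.\<close>

lemma nn_integral_tube_step:
  fixes h :: "real \<Rightarrow> real \<Rightarrow> ennreal"
  assumes "k < n" and [measurable]: "(\<lambda>(x, z). h x z) \<in> borel_measurable (borel \<Otimes>\<^sub>M borel)"
  shows "(\<integral>\<^sup>+\<omega>. indicator (tube r k) \<omega> * h (S k \<omega>) (X k \<omega>) \<partial>M)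
    = (\<integral>\<^sup>+\<omega>. indicator (tube r k) \<omega> * (\<integral>\<^sup>+z. h (S k \<omega>) z \<partial>std_normal_distribution) \<partial>M)"
proof -
  let ?P = "PiM {..<k} (\<lambda>_. borel :: real measure)"
  let ?V = "\<lambda>\<omega>. \<lambda>i\<in>{..<k}. X i \<omega>"
  define s where "s j v = \<sigma> * (\<Sum>i<j. v i)" for j and v :: "nat \<Rightarrow> real"
  let ?Q = "PiM {k} (\<lambda>_. borel :: real measure)"
  let ?W = "\<lambda>\<omega>. \<lambda>i\<in>{k}. X i \<omega>"
  define G where "G = (\<lambda>p. indicator {v. \<forall>j\<in>{..k}. \<bar>s j v\<bar> \<le> r j} (fst p) * h (s k (fst p)) (snd p k) :: ennreal)"
  have s: "s j (?V \<omega>) = S j \<omega>" if "j \<le> k" for j \<omega>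
    using that by (auto simp: s_def S_def intro!: arg_cong[where f="\<lambda>x. \<sigma> * x"] sum.cong)
  have ms: "s j \<in> borel_measurable ?P" if "j \<le> k" for j
    unfolding s_def using that
    by (intro borel_measurable_times borel_measurable_const borel_measurable_sum measurable_component_singleton) auto
  have "{v\<in>space ?P. \<forall>j\<in>{..k}. \<bar>s j v\<bar> \<le> r j} \<in> sets ?P"
    by (rule sets.sets_Collect_finite_All) (use ms in \<open>auto intro!: borel_measurable_le borel_measurable_abs\<close>)
  then have I: "indicator {v. \<forall>j\<in>{..k}. \<bar>s j v\<bar> \<le> r j} \<in> borel_measurable ?P"
    by (simp add: borel_measurable_indicator_iff Int_def conj_commute)
  have "(\<lambda>p. (s k (fst p), snd p k)) \<in> measurable (?P \<Otimes>\<^sub>M ?Q) (borel \<Otimes>\<^sub>M borel)"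
    by (intro measurable_Pair measurable_compose[OF measurable_fst ms]
        measurable_compose[OF measurable_snd measurable_component_singleton]) auto
  from measurable_compose[OF this assms(2)]
  have "(\<lambda>p. h (s k (fst p)) (snd p k)) \<in> borel_measurable (?P \<Otimes>\<^sub>M ?Q)" by simp
  then have G[measurable]: "G \<in> borel_measurable (?P \<Otimes>\<^sub>M ?Q)"
    unfolding G_def by (intro borel_measurable_times_ennreal measurable_compose[OF measurable_fst I])
  have ind: "indep_var ?P ?V ?Q ?W"
    using indep_var_restrict[OF indep, of "{..<k}" "{k}"] \<open>k < n\<close> by auto
  have GV: "G (?V \<omega>, ?W \<omega>') = indicator (tube r k) \<omega> * h (S k \<omega>) (X k \<omega>')" if "\<omega> \<in> space M" for \<omega> \<omega>'
    using that by (auto simp: G_def s tube_def indicator_def)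
  have "(\<integral>\<^sup>+\<omega>. indicator (tube r k) \<omega> * h (S k \<omega>) (X k \<omega>) \<partial>M) = (\<integral>\<^sup>+\<omega>. G (?V \<omega>, ?W \<omega>) \<partial>M)"
    by (intro nn_integral_cong) (simp only: GV)
  also have "\<dots> = (\<integral>\<^sup>+\<omega>. \<integral>\<^sup>+\<omega>'. G (?V \<omega>, ?W \<omega>') \<partial>M \<partial>M)"
    by (rule indep_var_nn_integral[OF ind G])
  also have "\<dots> = (\<integral>\<^sup>+\<omega>. \<integral>\<^sup>+\<omega>'. indicator (tube r k) \<omega> * h (S k \<omega>) (X k \<omega>') \<partial>M \<partial>M)"
    by (intro nn_integral_cong) (simp only: GV)
  also have "\<dots> = (\<integral>\<^sup>+\<omega>. \<integral>\<^sup>+z. indicator (tube r k) \<omega> * h (S k \<omega>) z \<partial>std_normal_distribution \<partial>M)"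
    using \<open>k < n\<close> unfolding std_normal[OF \<open>k < n\<close>, symmetric]
    by (intro nn_integral_cong nn_integral_distr[symmetric]) simp_all
  also have "\<dots> = (\<integral>\<^sup>+\<omega>. indicator (tube r k) \<omega> * (\<integral>\<^sup>+z. h (S k \<omega>) z \<partial>std_normal_distribution) \<partial>M)"
    by (intro nn_integral_cong nn_integral_cmult) measurable
  finally show ?thesis .
qed

lemma all_Suc_le: "(\<forall>j\<le>Suc k. P j) \<longleftrightarrow> (\<forall>j\<le>k. P j) \<and> P (Suc k)"
  by (auto elim: le_SucE)

lemma tube_Suc_indicator:
  "\<omega> \<in> space M \<Longrightarrow> indicator (tube r (Suc k)) \<omega>
    = indicator (tube r k) \<omega> * (indicator {z. \<bar>S k \<omega> + \<sigma> * z\<bar> \<le> r (Suc k)} (X k \<omega>) :: ennreal)"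
proof -
  assume "\<omega> \<in> space M"
  then have "\<omega> \<in> tube r (Suc k) \<longleftrightarrow> \<omega> \<in> tube r k \<and> \<bar>S k \<omega> + \<sigma> * X k \<omega>\<bar> \<le> r (Suc k)"
    by (simp add: tube_def S_Suc[symmetric] all_Suc_le)
  then show ?thesis by (simp add: indicator_def)
qed

lemma nn_integral_tube_Suc:
  fixes g :: "real \<Rightarrow> real"
  assumes "k < n" and [measurable]: "g \<in> borel_measurable borel"
    and g: "\<And>y. \<bar>y\<bar> \<le> r (Suc k) \<Longrightarrow> 0 \<le> g y \<and> g y \<le> 1"
  shows "(\<integral>\<^sup>+\<omega>. indicator (tube r (Suc k)) \<omega> * ennreal (g (S (Suc k) \<omega>)) \<partial>M)
    = (\<integral>\<^sup>+\<omega>. indicator (tube r k) \<omega> *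
        ennreal (\<integral>z. indicator {z. \<bar>S k \<omega> + \<sigma> * z\<bar> \<le> r (Suc k)} z * g (S k \<omega> + \<sigma> * z) \<partial>std_normal_distribution) \<partial>M)"
proof -
  interpret N: real_distribution std_normal_distribution by (rule real_dist_normal_dist)
  let ?h = "\<lambda>x z. indicator {z. \<bar>x + \<sigma> * z\<bar> \<le> r (Suc k)} z * ennreal (g (x + \<sigma> * z))"
  have inner: "(\<integral>\<^sup>+z. ?h x z \<partial>std_normal_distribution)
    = ennreal (\<integral>z. indicator {z. \<bar>x + \<sigma> * z\<bar> \<le> r (Suc k)} z * g (x + \<sigma> * z) \<partial>std_normal_distribution)" for x
  proof -
    have "(\<integral>\<^sup>+z. ?h x z \<partial>std_normal_distribution)
       = (\<integral>\<^sup>+z. ennreal (indicator {z. \<bar>x + \<sigma> * z\<bar> \<le> r (Suc k)} z * g (x + \<sigma> * z)) \<partial>std_normal_distribution)"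
      by (intro nn_integral_cong) (auto simp: indicator_def)
    also have "\<dots> = ennreal (\<integral>z. indicator {z. \<bar>x + \<sigma> * z\<bar> \<le> r (Suc k)} z * g (x + \<sigma> * z) \<partial>std_normal_distribution)"
    proof (rule nn_integral_eq_integral)
      show "integrable std_normal_distribution (\<lambda>z. indicator {z. \<bar>x + \<sigma> * z\<bar> \<le> r (Suc k)} z * g (x + \<sigma> * z))"
        by (rule N.integrable_const_bound[where B=1]) (use g in \<open>auto simp: indicator_def\<close>)
    qed (use g in \<open>auto simp: indicator_def\<close>)
    finally show ?thesis .
  qed
  have "(\<integral>\<^sup>+\<omega>. indicator (tube r (Suc k)) \<omega> * ennreal (g (S (Suc k) \<omega>)) \<partial>M)
    = (\<integral>\<^sup>+\<omega>. indicator (tube r k) \<omega> * ?h (S k \<omega>) (X k \<omega>) \<partial>M)"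
    by (intro nn_integral_cong) (simp add: tube_Suc_indicator S_Suc mult.assoc)
  also have "\<dots> = (\<integral>\<^sup>+\<omega>. indicator (tube r k) \<omega> * (\<integral>\<^sup>+z. ?h (S k \<omega>) z \<partial>std_normal_distribution) \<partial>M)"
    by (rule nn_integral_tube_step[OF \<open>k < n\<close>]) (simp add: split_beta' indicator_def)
  finally show ?thesis by (simp only: inner)
qed

text \<open>The expectation of \<open>cos (\<pi> S\<^sub>k / (2 r\<^sub>k))\<close> on the tube event loses at most the factor
  \<open>exp (- \<pi>\<^sup>2 \<sigma>\<^sup>2 / (8 r\<^sub>k\<^sup>2))\<close> in each step.  The cosine may be exchanged for the one of the next radius
  before the step is made: on the current tube a wider cosine is larger.\<close>

theorem tube_prob_lower:
  assumes r_pos: "\<And>k. 0 < r k" and r_mono: "\<And>k. r k \<le> r (Suc k)"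
  shows "exp (- (pi\<^sup>2 / 8 * (\<Sum>k=1..n. \<sigma>\<^sup>2 / (r k)\<^sup>2))) \<le> prob (tube r n)"
proof -
  let ?\<theta> = "\<lambda>k. pi / (2 * r k)"
  let ?a = "\<lambda>k. \<integral>\<^sup>+\<omega>. indicator (tube r k) \<omega> * ennreal (cos (?\<theta> k * S k \<omega>)) \<partial>M"
  have le: "\<bar>pi / (2 * w) * x\<bar> \<le> pi / 2" if "\<bar>x\<bar> \<le> w" "0 < w" for x w :: real
    using that by (simp add: abs_mult pos_divide_le_eq)
  have "k \<le> n \<Longrightarrow> ennreal (exp (- (pi\<^sup>2 / 8 * (\<Sum>j=1..k. \<sigma>\<^sup>2 / (r j)\<^sup>2)))) \<le> ?a k" for k
  proof (induction k)
    case 0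
    have "tube r 0 = space M" using r_pos[of 0] by (auto simp: tube_def)
    then show ?case by (simp add: emeasure_space_1)
  next
    case (Suc k)
    let ?l = "exp (- (?\<theta> (Suc k) * \<sigma>)\<^sup>2 / 2)"
    have [measurable]: "S k \<in> borel_measurable M" "tube r k \<in> sets M"
      using Suc.prems by (simp_all add: S_measurable tube_sets)
    have l: "?l = exp (- (pi\<^sup>2 / 8 * (\<sigma>\<^sup>2 / (r (Suc k))\<^sup>2)))"
      by (simp add: power_mult_distrib power_divide)
    have "ennreal (exp (- (pi\<^sup>2 / 8 * (\<Sum>j=1..Suc k. \<sigma>\<^sup>2 / (r j)\<^sup>2))))
        = ennreal ?l * ennreal (exp (- (pi\<^sup>2 / 8 * (\<Sum>j=1..k. \<sigma>\<^sup>2 / (r j)\<^sup>2))))"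
      unfolding l by (simp add: ennreal_mult'[symmetric] exp_add[symmetric] distrib_left)
    also have "\<dots> \<le> ennreal ?l * ?a k" using Suc by (intro mult_left_mono) auto
    also have "\<dots> = (\<integral>\<^sup>+\<omega>. ennreal ?l * (indicator (tube r k) \<omega> * ennreal (cos (?\<theta> k * S k \<omega>))) \<partial>M)"
      by (rule nn_integral_cmult[symmetric]) measurable
    also have "\<dots> \<le> (\<integral>\<^sup>+\<omega>. indicator (tube r k) \<omega> * ennreal (\<integral>z. indicator {z. \<bar>S k \<omega> + \<sigma> * z\<bar> \<le> r (Suc k)} z
        * cos (?\<theta> (Suc k) * (S k \<omega> + \<sigma> * z)) \<partial>std_normal_distribution) \<partial>M)"
    proof (intro nn_integral_mono)
      fix \<omega>
      show "ennreal ?l * (indicator (tube r k) \<omega> * ennreal (cos (?\<theta> k * S k \<omega>)))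
        \<le> indicator (tube r k) \<omega> * ennreal (\<integral>z. indicator {z. \<bar>S k \<omega> + \<sigma> * z\<bar> \<le> r (Suc k)} z
        * cos (?\<theta> (Suc k) * (S k \<omega> + \<sigma> * z)) \<partial>std_normal_distribution)"
      proof (cases "\<omega> \<in> tube r k")
        case True
        then have S: "\<bar>S k \<omega>\<bar> \<le> r k" by (auto simp: tube_def)
        have "cos (?\<theta> k * S k \<omega>) = cos \<bar>?\<theta> k * S k \<omega>\<bar>" by (rule cos_abs_real[symmetric])
        also have "\<dots> \<le> cos \<bar>?\<theta> (Suc k) * S k \<omega>\<bar>"
        proof (rule cos_monotone_0_pi_le)
          show "\<bar>?\<theta> (Suc k) * S k \<omega>\<bar> \<le> \<bar>?\<theta> k * S k \<omega>\<bar>"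
            using r_pos[of k] r_pos[of "Suc k"] r_mono[of k]
            by (simp only: abs_mult) (auto intro!: mult_right_mono divide_left_mono)
          show "\<bar>?\<theta> k * S k \<omega>\<bar> \<le> pi" using le[OF S r_pos] pi_gt_zero by linarith
        qed simp
        also have "\<dots> = cos (?\<theta> (Suc k) * S k \<omega>)" by (rule cos_abs_real)
        finally have "?l * cos (?\<theta> k * S k \<omega>) \<le> ?l * cos (?\<theta> (Suc k) * S k \<omega>)"
          by (intro mult_left_mono) auto
        also have "\<dots> \<le> (\<integral>z. indicator {z. \<bar>S k \<omega> + \<sigma> * z\<bar> \<le> r (Suc k)} z
          * cos (?\<theta> (Suc k) * (S k \<omega> + \<sigma> * z)) \<partial>std_normal_distribution)"
          using S r_mono[of k] by (intro std_normal_cos_step_lower r_pos \<sigma>_pos) simp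
        finally show ?thesis using True
          by (simp add: ennreal_mult'[symmetric] ennreal_leI)
      qed auto
    qed
    also have "\<dots> = ?a (Suc k)"
    proof (rule nn_integral_tube_Suc[symmetric])
      show "0 \<le> cos (?\<theta> (Suc k) * y) \<and> cos (?\<theta> (Suc k) * y) \<le> 1" if "\<bar>y\<bar> \<le> r (Suc k)" for y
        using le[OF that r_pos] unfolding abs_le_iff by (intro conjI cos_ge_zero cos_le_one) linarith+
    qed (use Suc.prems in auto)
    finally show ?case .
  qed
  from this[OF order_refl] have "ennreal (exp (- (pi\<^sup>2 / 8 * (\<Sum>j=1..n. \<sigma>\<^sup>2 / (r j)\<^sup>2)))) \<le> ?a n" .
  also have "\<dots> \<le> (\<integral>\<^sup>+\<omega>. indicator (tube r n) \<omega> \<partial>M)"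
    by (intro nn_integral_mono) (auto simp: indicator_def)
  also have "\<dots> = ennreal (prob (tube r n))"
    by (simp add: emeasure_eq_measure tube_sets)
  finally show ?thesis by (simp only: ennreal_le_iff[OF measure_nonneg])
qed

text \<open>The radius and frequency at time \<open>k\<close> depend on \<open>k\<close> only through a stage \<open>\<iota> k\<close>.  Passing to the cosine
  of a new stage increases the expectation by at most the factor \<open>1 / c\<close>, because all cosines lie in
  \<open>[c, 1]\<close> on their tubes.  This is why the constant in front is a power of \<open>1 / c\<close> in the number of
  stages, whatever the number of steps.\<close>

theorem tube_prob_upper:
  fixes \<iota> :: "nat \<Rightarrow> nat" and R \<Theta> :: "nat \<Rightarrow> real"
  assumes \<iota>: "\<And>k. \<iota> k \<le> \<iota> (Suc k)" and R: "\<And>k. 0 < R (\<iota> k)" and \<Theta>: "\<And>k. 0 < \<Theta> (\<iota> k)"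
    and R_mono: "\<And>k. R (\<iota> k) \<le> R (\<iota> (Suc k))" and lt: "\<And>k. R (\<iota> k) < pi / (2 * \<Theta> (\<iota> k))"
    and c: "0 < c" "\<And>k. c \<le> cos (\<Theta> (\<iota> k) * R (\<iota> k))"
  shows "prob (tube (\<lambda>k. R (\<iota> k)) n) \<le> (1 / c) ^ Suc (\<iota> n - \<iota> 0) *
    (\<Prod>k=1..n. exp (- (\<Theta> (\<iota> k) * \<sigma>)\<^sup>2 / 2) + 3 * (\<sigma> / (pi / (2 * \<Theta> (\<iota> k)) - R (\<iota> k))) ^ 4 / c)"
proof -
  let ?r = "\<lambda>k. R (\<iota> k)" and ?\<theta> = "\<lambda>k. \<Theta> (\<iota> k)"
  let ?\<mu> = "\<lambda>k. exp (- (?\<theta> k * \<sigma>)\<^sup>2 / 2) + 3 * (\<sigma> / (pi / (2 * ?\<theta> k) - ?r k)) ^ 4 / c"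
  let ?a = "\<lambda>k. \<integral>\<^sup>+\<omega>. indicator (tube ?r k) \<omega> * ennreal (cos (?\<theta> k * S k \<omega>)) \<partial>M"
  have c1: "c \<le> 1" by (rule order_trans[OF c(2)[of 0] cos_le_one])
  have \<mu>: "0 \<le> ?\<mu> k" for k using c(1) by (intro add_nonneg_nonneg divide_nonneg_nonneg) auto
  have cos_ge: "c \<le> cos (?\<theta> k * x)" if "\<bar>x\<bar> \<le> ?r k" for k x
  proof -
    have "c \<le> cos (?\<theta> k * ?r k)" by (rule c)
    also have "\<dots> \<le> cos \<bar>?\<theta> k * x\<bar>"
    proof (rule cos_monotone_0_pi_le)
      show "\<bar>?\<theta> k * x\<bar> \<le> ?\<theta> k * ?r k" using that \<Theta>[of k] by (simp add: abs_mult)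
      have "?\<theta> k * ?r k \<le> ?\<theta> k * (pi / (2 * ?\<theta> k))" using lt[of k] \<Theta>[of k] by (intro mult_left_mono) auto
      also have "\<dots> = pi / 2" using \<Theta>[of k] by simp
      finally show "?\<theta> k * ?r k \<le> pi" using pi_gt_zero by linarith
    qed simp
    finally show ?thesis by (simp only: cos_abs_real)
  qed
  have "k \<le> n \<Longrightarrow> ?a k \<le> ennreal ((1 / c) ^ (\<iota> k - \<iota> 0) * (\<Prod>j=1..k. ?\<mu> j))" for k
  proof (induction k)
    case 0
    have "tube ?r 0 = space M" using R[of 0] by (auto simp: tube_def)
    then show ?case by (simp add: emeasure_space_1)
  next
    case (Suc k)
    have [measurable]: "S k \<in> borel_measurable M" "tube ?r k \<in> sets M"
      using Suc.prems by (simp_all add: S_measurable tube_sets)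
    let ?e = "\<iota> (Suc k) - \<iota> k"
    have "?a (Suc k) = (\<integral>\<^sup>+\<omega>. indicator (tube ?r k) \<omega> * ennreal (\<integral>z. indicator {z. \<bar>S k \<omega> + \<sigma> * z\<bar> \<le> ?r (Suc k)} z
        * cos (?\<theta> (Suc k) * (S k \<omega> + \<sigma> * z)) \<partial>std_normal_distribution) \<partial>M)"
    proof (rule nn_integral_tube_Suc)
      show "0 \<le> cos (?\<theta> (Suc k) * y) \<and> cos (?\<theta> (Suc k) * y) \<le> 1" if "\<bar>y\<bar> \<le> ?r (Suc k)" for y
        using cos_ge[OF that] c by auto
    qed (use Suc.prems in auto)
    also have "\<dots> \<le> (\<integral>\<^sup>+\<omega>. ennreal (?\<mu> (Suc k) * (1 / c) ^ ?e) * (indicator (tube ?r k) \<omega> * ennreal (cos (?\<theta> k * S k \<omega>))) \<partial>M)"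
    proof (intro nn_integral_mono)
      fix \<omega>
      show "indicator (tube ?r k) \<omega> * ennreal (\<integral>z. indicator {z. \<bar>S k \<omega> + \<sigma> * z\<bar> \<le> ?r (Suc k)} z
        * cos (?\<theta> (Suc k) * (S k \<omega> + \<sigma> * z)) \<partial>std_normal_distribution)
       \<le> ennreal (?\<mu> (Suc k) * (1 / c) ^ ?e) * (indicator (tube ?r k) \<omega> * ennreal (cos (?\<theta> k * S k \<omega>)))"
      proof (cases "\<omega> \<in> tube ?r k")
        case True
        let ?x = "S k \<omega>"
        have x: "\<bar>?x\<bar> \<le> ?r k" using True by (auto simp: tube_def)
        have T: "(\<integral>z. indicator {z. \<bar>?x + \<sigma> * z\<bar> \<le> ?r (Suc k)} z
          * cos (?\<theta> (Suc k) * (?x + \<sigma> * z)) \<partial>std_normal_distribution) \<le> ?\<mu> (Suc k) * ((1 / c) ^ ?e * cos (?\<theta> k * ?x))"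
        proof -
          let ?y = "cos (?\<theta> (Suc k) * ?x)" and ?\<epsilon> = "3 * (\<sigma> / (pi / (2 * ?\<theta> (Suc k)) - ?r (Suc k))) ^ 4"
          have x': "\<bar>?x\<bar> \<le> ?r (Suc k)" using x R_mono[of k] by linarith
          have "(\<integral>z. indicator {z. \<bar>?x + \<sigma> * z\<bar> \<le> ?r (Suc k)} z
            * cos (?\<theta> (Suc k) * (?x + \<sigma> * z)) \<partial>std_normal_distribution)
            \<le> exp (- (?\<theta> (Suc k) * \<sigma>)\<^sup>2 / 2) * ?y + ?\<epsilon>"
            by (rule std_normal_cos_step_upper[OF R \<Theta> lt x' HOL.refl])
          also have "?\<epsilon> \<le> ?\<epsilon> / c * ?y"
            using cos_ge[OF x'] c(1) mult_left_mono[of c ?y "?\<epsilon>"] by (simp add: pos_le_divide_eq)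
          finally have "(\<integral>z. indicator {z. \<bar>?x + \<sigma> * z\<bar> \<le> ?r (Suc k)} z
            * cos (?\<theta> (Suc k) * (?x + \<sigma> * z)) \<partial>std_normal_distribution) \<le> ?\<mu> (Suc k) * ?y"
            by (simp add: distrib_right)
          also have "?y \<le> (1 / c) ^ ?e * cos (?\<theta> k * ?x)"
          proof (cases "?e = 0")
            case True
            then have "\<iota> (Suc k) = \<iota> k" using \<iota>[of k] by simp
            then show ?thesis by simp
          next
            case False
            have "?y \<le> 1" by simp
            also have "1 \<le> 1 / c * cos (?\<theta> k * ?x)" using cos_ge[OF x] c(1) by simp
            also have "\<dots> \<le> (1 / c) ^ ?e * cos (?\<theta> k * ?x)"
              using False c1 c(1) cos_ge[OF x] self_le_power[of "1 / c" ?e]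
              by (intro mult_right_mono) auto
            finally show ?thesis .
          qed
          finally show ?thesis using \<mu>[of "Suc k"] by (simp add: mult_left_mono)
        qed
        then show ?thesis using True \<mu>[of "Suc k"] c
          by (simp add: ennreal_mult'[symmetric] ennreal_leI mult.assoc)
      qed auto
    qed
    also have "\<dots> = ennreal (?\<mu> (Suc k) * (1 / c) ^ ?e) * ?a k"
      by (rule nn_integral_cmult) measurable
    also have "\<dots> \<le> ennreal (?\<mu> (Suc k) * (1 / c) ^ ?e) * ennreal ((1 / c) ^ (\<iota> k - \<iota> 0) * (\<Prod>j=1..k. ?\<mu> j))"
      using Suc by (intro mult_left_mono) auto
    also have "\<dots> = ennreal ((1 / c) ^ (\<iota> (Suc k) - \<iota> 0) * (\<Prod>j=1..Suc k. ?\<mu> j))"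
    proof -
      have "\<iota> 0 \<le> \<iota> k" using lift_Suc_mono_le[of \<iota> 0 k] \<iota> by auto
      then have "\<iota> (Suc k) - \<iota> 0 = ?e + (\<iota> k - \<iota> 0)" using \<iota>[of k] by simp
      then show ?thesis
        using \<mu> c by (subst ennreal_mult'[symmetric]) (auto simp: power_add ac_simps intro!: mult_nonneg_nonneg)
    qed
    finally show ?case .
  qed
  from this[OF order_refl] have a: "?a n \<le> ennreal ((1 / c) ^ (\<iota> n - \<iota> 0) * (\<Prod>j=1..n. ?\<mu> j))" .
  have [measurable]: "tube ?r n \<in> sets M" by (simp add: tube_sets)
  have "ennreal (c * prob (tube ?r n)) = (\<integral>\<^sup>+\<omega>. ennreal c * indicator (tube ?r n) \<omega> \<partial>M)"
    using c by (simp add: nn_integral_cmult emeasure_eq_measure ennreal_mult')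
  also have "\<dots> \<le> ?a n"
    using cos_ge by (intro nn_integral_mono) (auto simp: indicator_def tube_def intro!: ennreal_leI)
  also note a
  finally have "c * prob (tube ?r n) \<le> (1 / c) ^ (\<iota> n - \<iota> 0) * (\<Prod>j=1..n. ?\<mu> j)"
    using \<mu> c by (subst (asm) ennreal_le_iff) (auto intro!: mult_nonneg_nonneg prod_nonneg)
  then show ?thesis using c by (simp add: field_simps)
qed

end

section \<open>Brownian motion in a widening tube\<close>

lemma mono_upto:
  fixes f :: "nat \<Rightarrow> real"
  assumes "\<And>i. a \<le> i \<Longrightarrow> i < m \<Longrightarrow> f i \<le> f (Suc i)" "a \<le> i" "i \<le> j" "j \<le> m"
  shows "f i \<le> f j"
  using assms(3,4,2)
proof (induction j rule: dec_induct)
  case (step j)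
  then have "f i \<le> f j" by simp
  also have "\<dots> \<le> f (Suc j)" using step by (intro assms(1)) auto
  finally show ?case .
qed simp

text \<open>The stage of the time \<open>s\<close> when stage \<open>i\<close> ends at time \<open>c i\<close>; times after \<open>c m\<close> are counted to the last stage, so
  that the value always lies in \<open>{1..m}\<close>.\<close>

definition stage :: "(nat \<Rightarrow> real) \<Rightarrow> nat \<Rightarrow> real \<Rightarrow> nat" where
  "stage c m s = (LEAST i. 1 \<le> i \<and> (s \<le> c i \<or> m \<le> i))"

lemma stage_bounds:
  assumes "1 \<le> m" shows "1 \<le> stage c m s" "stage c m s \<le> m" "s \<le> c (stage c m s) \<or> stage c m s = m"
proof -
  let ?P = "\<lambda>i. 1 \<le> i \<and> (s \<le> c i \<or> m \<le> i)"
  have "?P m" using assms by simp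
  then have "?P (stage c m s)" and le: "stage c m s \<le> m"
    unfolding stage_def by (rule LeastI, rule Least_le)
  then show "1 \<le> stage c m s" "stage c m s \<le> m" "s \<le> c (stage c m s) \<or> stage c m s = m" by auto
qed

lemma stage_le: "1 \<le> i \<Longrightarrow> s \<le> c i \<Longrightarrow> stage c m s \<le> i"
  unfolding stage_def by (rule Least_le) simp

lemma stage_mono:
  assumes "1 \<le> m" "s \<le> s'" shows "stage c m s \<le> stage c m s'"
  using stage_bounds[OF assms(1), where c=c and s=s'] stage_bounds[OF assms(1), where c=c and s=s] stage_le[of "stage c m s'" s c m] assms(2)
  by linarith

lemma abel_sum:
  fixes d c :: "nat \<Rightarrow> real"
  assumes "1 \<le> m" "c 0 = 0"
  shows "(\<Sum>i=1..m. d i * (c i - c (i - 1))) = d m * c m + (\<Sum>j=1..<m. (d j - d (Suc j)) * c j)"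
proof -
  have "(\<Sum>i=1..Suc n. d i * (c i - c (i - 1))) = d (Suc n) * c (Suc n) + (\<Sum>j=1..<Suc n. (d j - d (Suc j)) * c j)" for n
  proof (induction n)
    case 0
    show ?case using assms(2) by simp
  next
    case (Suc n)
    have 1: "(\<Sum>i=1..Suc (Suc n). d i * (c i - c (i - 1)))
        = (\<Sum>i=1..Suc n. d i * (c i - c (i - 1))) + d (Suc (Suc n)) * (c (Suc (Suc n)) - c (Suc n))"
      by simp
    have 2: "(\<Sum>j=1..<Suc (Suc n). (d j - d (Suc j)) * c j)
        = (\<Sum>j=1..<Suc n. (d j - d (Suc j)) * c j) + (d (Suc n) - d (Suc (Suc n))) * c (Suc n)"
      by simp
    show ?case unfolding 1 2 Suc.IH by algebra
  qed
  from this[of "m - 1"] show ?thesis using assms(1) by simp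
qed

text \<open>The Riemann sum of the step function with value \<open>d i\<close> on \<open>(c (i - 1), c i]\<close>.  After summation by parts both
  sums are combinations, with nonnegative coefficients \<open>d j - d (j + 1)\<close> and \<open>d m\<close>, of the \<open>c j\<close> and
  of their roundings to the grid, and these coefficients add up to \<open>d 1\<close>.\<close>

lemma grid_sum:
  fixes d c :: "nat \<Rightarrow> real"
  assumes m: "1 \<le> m" and c0: "c 0 = 0" "\<And>i. i < m \<Longrightarrow> c i \<le> c (Suc i)"
    and d: "0 < d m" "\<And>i. 1 \<le> i \<Longrightarrow> i < m \<Longrightarrow> d (Suc i) \<le> d i" and "0 < \<delta>"
  defines "s \<equiv> (\<Sum>k=1..nat \<lfloor>c m / \<delta>\<rfloor>. \<delta> * d (stage c m (real k * \<delta>)))"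
    and "T \<equiv> (\<Sum>i=1..m. d i * (c i - c (i - 1)))"
  shows "s \<le> T" "T - \<delta> * d 1 \<le> s"
proof -
  define N where "N = nat \<lfloor>c m / \<delta>\<rfloor>"
  have c_mono: "c i \<le> c j" if "i \<le> j" "j \<le> m" for i j
    by (rule mono_upto[of 0 m c]) (use c0(2) that in auto)
  have initial_segment: "{k\<in>{1..N}. k \<le> n} = {1..n}" if "n \<le> N" for n
    using that by auto
  have cnt: "card {k\<in>{1..N}. real k * \<delta> \<le> c j} = nat \<lfloor>c j / \<delta>\<rfloor>" if "j \<le> m" for j
  proof -
    have "c j / \<delta> \<le> c m / \<delta>" using c_mono[OF that] \<open>0 < \<delta>\<close> by (simp add: divide_right_mono)
    then have le: "nat \<lfloor>c j / \<delta>\<rfloor> \<le> N" unfolding N_def by (intro nat_mono floor_mono)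
    have "0 \<le> c j" using c_mono[of 0 j] c0 that by simp
    then have iff: "real k * \<delta> \<le> c j \<longleftrightarrow> k \<le> nat \<lfloor>c j / \<delta>\<rfloor>" for k
      using \<open>0 < \<delta>\<close> by (simp add: le_nat_floor pos_le_divide_eq[symmetric] le_nat_iff le_floor_iff)
    have "{k\<in>{1..N}. real k * \<delta> \<le> c j} = {1..nat \<lfloor>c j / \<delta>\<rfloor>}"
      unfolding iff by (rule initial_segment[OF le])
    then show ?thesis by simp
  qed
  \<comment> \<open>\<open>d\<close> at the current stage as a telescoping sum over the stages that are not yet over.\<close>
  have d_stage: "d (stage c m (real k * \<delta>)) = d m + (\<Sum>j=1..<m. (d j - d (Suc j)) * of_bool (real k * \<delta> \<le> c j))" for k
  proof -
    let ?i = "stage c m (real k * \<delta>)"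
    note b = stage_bounds[OF m, where c=c and s="real k * \<delta>"]
    have iff: "real k * \<delta> \<le> c j \<longleftrightarrow> ?i \<le> j" if "j \<in> {1..<m}" for j
      using that b stage_le[of j "real k * \<delta>" c m] c_mono[of ?i j] by fastforce
    have "(\<Sum>j=1..<m. (d j - d (Suc j)) * of_bool (real k * \<delta> \<le> c j)) = (\<Sum>j=1..<m. (d j - d (Suc j)) * of_bool (?i \<le> j))"
      by (intro sum.cong refl) (simp add: iff)
    also have "\<dots> = (\<Sum>j=?i..<m. (d j - d (Suc j)))"
      using b by (intro sum.mono_neutral_cong_right) (auto)
    also have "\<dots> = - (\<Sum>j=?i..<m. (d (Suc j) - d j))" by (simp add: sum_negf[symmetric])
    also have "\<dots> = d ?i - d m" using b by (simp add: sum_Suc_diff')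
    finally show ?thesis by simp
  qed
  \<comment> \<open>The end of stage \<open>j\<close>, rounded down to the grid.\<close>
  define f where "f j = \<delta> * real (nat \<lfloor>c j / \<delta>\<rfloor>)" for j
  have f: "c j - \<delta> \<le> f j" "f j \<le> c j" if "j \<le> m" for j
  proof -
    have "0 \<le> c j / \<delta>" using c_mono[of 0 j] c0 that \<open>0 < \<delta>\<close> by simp
    then have e: "real (nat \<lfloor>c j / \<delta>\<rfloor>) = of_int \<lfloor>c j / \<delta>\<rfloor>" by simp
    have b: "of_int \<lfloor>c j / \<delta>\<rfloor> \<le> c j / \<delta>" "c j / \<delta> - 1 \<le> of_int \<lfloor>c j / \<delta>\<rfloor>" by linarith+
    have "\<delta> * real (nat \<lfloor>c j / \<delta>\<rfloor>) \<le> \<delta> * (c j / \<delta>)" "\<delta> * (c j / \<delta> - 1) \<le> \<delta> * real (nat \<lfloor>c j / \<delta>\<rfloor>)"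
      unfolding e by (rule mult_left_mono[OF b(1)] mult_left_mono[OF b(2)], use \<open>0 < \<delta>\<close> in simp)+
    moreover have "\<delta> * (c j / \<delta>) = c j" using \<open>0 < \<delta>\<close> by simp
    ultimately show "c j - \<delta> \<le> f j" "f j \<le> c j" unfolding f_def right_diff_distrib by linarith+
  qed
  have "s = (\<Sum>k=1..N. \<delta> * d m + (\<Sum>j=1..<m. \<delta> * ((d j - d (Suc j)) * of_bool (real k * \<delta> \<le> c j))))"
    unfolding s_def N_def[symmetric] d_stage by (simp only: distrib_left sum_distrib_left)
  also have "\<dots> = d m * f m + (\<Sum>j=1..<m. (d j - d (Suc j)) * f j)"
  proof -
    have "(\<Sum>k=1..N. of_bool (real k * \<delta> \<le> c j)) = real (nat \<lfloor>c j / \<delta>\<rfloor>)" if "j \<le> m" for j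
      using cnt[OF that] by (simp add: of_bool_def sum.If_cases Int_def)
    then have "(\<Sum>k=1..N. \<Sum>j=1..<m. \<delta> * ((d j - d (Suc j)) * of_bool (real k * \<delta> \<le> c j)))
      = (\<Sum>j=1..<m. (d j - d (Suc j)) * f j)"
      by (subst sum.swap, intro sum.cong refl) (simp add: f_def sum_distrib_left[symmetric] mult_ac)
    then show ?thesis by (simp add: sum.distrib f_def N_def)
  qed
  finally have s: "s = d m * f m + (\<Sum>j=1..<m. (d j - d (Suc j)) * f j)" .
  have T: "T = d m * c m + (\<Sum>j=1..<m. (d j - d (Suc j)) * c j)"
    unfolding T_def by (rule abel_sum[where c=c, OF m c0(1)])
  show "s \<le> T" unfolding s T
    using d f by (intro add_mono sum_mono mult_left_mono) auto
  have "d m * (c m - \<delta>) + (\<Sum>j=1..<m. (d j - d (Suc j)) * (c j - \<delta>)) \<le> s" unfolding s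
    using d f by (intro add_mono sum_mono mult_left_mono) auto
  also have "d m * (c m - \<delta>) + (\<Sum>j=1..<m. (d j - d (Suc j)) * (c j - \<delta>))
      = T - \<delta> * (d m - (\<Sum>j=1..<m. d (Suc j) - d j))"
  proof -
    have "(\<Sum>j=1..<m. (d j - d (Suc j)) * (c j - \<delta>)) = (\<Sum>j=1..<m. (d j - d (Suc j)) * c j + \<delta> * (d (Suc j) - d j))"
      by (intro sum.cong HOL.refl) algebra
    also have "\<dots> = (\<Sum>j=1..<m. (d j - d (Suc j)) * c j) + \<delta> * (\<Sum>j=1..<m. d (Suc j) - d j)"
      unfolding sum.distrib sum_distrib_left[symmetric] ..
    finally show ?thesis unfolding T by algebra
  qed
  also have "d m - (\<Sum>j=1..<m. d (Suc j) - d j) = d 1" using m by (simp add: sum_Suc_diff')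
  finally show "T - \<delta> * d 1 \<le> s" .
qed

context prob_space begin

lemma brownian_gaussian_walk:
  assumes "standard_brownian_motion B" "0 < \<delta>"
  shows "gaussian_walk M (\<lambda>i \<omega>. (B (real (Suc i) * \<delta>) \<omega> - B (real i * \<delta>) \<omega>) / sqrt \<delta>) n (sqrt \<delta>)"
proof unfold_locales
  let ?s = "\<lambda>i. real i * \<delta>"
  have "indep_vars (\<lambda>_. borel) (\<lambda>i \<omega>. B (?s (Suc i)) \<omega> - B (?s i) \<omega>) {..<n}"
    using assms unfolding standard_brownian_motion_def by (elim conjE allE[of _ n] allE[of _ ?s]) auto
  then show "indep_vars (\<lambda>_. borel) (\<lambda>i \<omega>. (B (real (Suc i) * \<delta>) \<omega> - B (real i * \<delta>) \<omega>) / sqrt \<delta>) {..<n}"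
    by (rule indep_vars_compose2) simp
  fix i
  have "0 \<le> ?s i \<and> ?s i < ?s (Suc i)" using \<open>0 < \<delta>\<close> by simp
  then have "distributed M lborel (\<lambda>\<omega>. B (?s (Suc i)) \<omega> - B (?s i) \<omega>) (normal_density 0 (sqrt (?s (Suc i) - ?s i)))"
    using assms unfolding standard_brownian_motion_def by blast
  moreover have "?s (Suc i) - ?s i = \<delta>" by (simp add: algebra_simps)
  ultimately have "distributed M lborel (\<lambda>\<omega>. B (?s (Suc i)) \<omega> - B (?s i) \<omega>) (normal_density 0 (sqrt \<delta>))" by simp
  then have "distributed M lborel (\<lambda>\<omega>. (B (?s (Suc i)) \<omega> - B (?s i) \<omega>) / sqrt \<delta>) std_normal_density"
    using normal_standard_normal_convert[of "sqrt \<delta>" "\<lambda>\<omega>. B (?s (Suc i)) \<omega> - B (?s i) \<omega>" 0] \<open>0 < \<delta>\<close> by simp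
  then show "distr M borel (\<lambda>\<omega>. (B (real (Suc i) * \<delta>) \<omega> - B (real i * \<delta>) \<omega>) / sqrt \<delta>) = std_normal_distribution"
    by (simp add: distributed_distr_eq_density[symmetric] cong: distr_cong)
qed (use assms in auto)

definition grid_event :: "(real \<Rightarrow> 'a \<Rightarrow> real) \<Rightarrow> nat \<Rightarrow> (nat \<Rightarrow> real) \<Rightarrow> (nat \<Rightarrow> real) \<Rightarrow> real \<Rightarrow> 'a set" where
  "grid_event B m \<beta> c \<delta> = {\<omega>\<in>space M. \<forall>i\<in>{1..m}. \<forall>k::nat. real k * \<delta> \<le> c i \<longrightarrow> \<bar>B (real k * \<delta>) \<omega>\<bar> \<le> \<beta> i}"

lemma grid_event_sets:
  assumes "standard_brownian_motion B" "0 < \<delta>"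
  shows "grid_event B m \<beta> c \<delta> \<in> sets M"
proof -
  have [measurable]: "B (real k * \<delta>) \<in> borel_measurable M" for k :: nat
    using assms by (auto simp: standard_brownian_motion_def)
  show ?thesis unfolding grid_event_def by measurable
qed

text \<open>A time before \<open>c i\<close> is in stage \<open>i\<close> or earlier.  As \<open>\<beta>\<close> increases, the binding constraint is the one of the
  current stage, so the grid event is a tube event for the sampled walk, up to the null set where
  \<open>B 0 \<noteq> 0\<close>.\<close>

lemma prob_grid_event:
  assumes bm: "standard_brownian_motion B" and \<delta>: "0 < \<delta>" and m: "1 \<le> m"
    and c: "c 0 = 0" "\<And>i. i < m \<Longrightarrow> c i \<le> c (Suc i)"
    and \<beta>: "\<And>i. 1 \<le> i \<Longrightarrow> i < m \<Longrightarrow> \<beta> i \<le> \<beta> (Suc i)"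
  defines "X \<equiv> (\<lambda>i \<omega>. (B (real (Suc i) * \<delta>) \<omega> - B (real i * \<delta>) \<omega>) / sqrt \<delta>)"
  shows "prob (grid_event B m \<beta> c \<delta>) = prob (gaussian_walk.tube M X (sqrt \<delta>)
    (\<lambda>k. \<beta> (stage c m (real k * \<delta>))) (nat \<lfloor>c m / \<delta>\<rfloor>))"
proof -
  let ?N = "nat \<lfloor>c m / \<delta>\<rfloor>" and ?i = "\<lambda>k. stage c m (real k * \<delta>)"
  interpret W: gaussian_walk M X ?N "sqrt \<delta>"
    unfolding X_def by (rule brownian_gaussian_walk[OF bm \<delta>])
  have S: "W.S k \<omega> = B (real k * \<delta>) \<omega> - B 0 \<omega>" for k \<omega>
  proof -
    have "W.S k \<omega> = (\<Sum>i<k. B (real (Suc i) * \<delta>) \<omega> - B (real i * \<delta>) \<omega>)"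
      using \<delta> unfolding W.S_def unfolding X_def by (simp add: sum_distrib_left)
    also have "\<dots> = B (real k * \<delta>) \<omega> - B (real 0 * \<delta>) \<omega>"
      by (rule sum_lessThan_telescope[where f="\<lambda>i. B (real i * \<delta>) \<omega>"])
    finally show ?thesis by simp
  qed
  have c_mono: "c i \<le> c j" if "i \<le> j" "j \<le> m" for i j
    by (rule mono_upto[of 0 m c]) (use c(2) that in auto)
  have \<beta>_mono: "\<beta> i \<le> \<beta> j" if "1 \<le> i" "i \<le> j" "j \<le> m" for i j
    by (rule mono_upto[of 1 m \<beta>]) (use \<beta> that in auto)
  have N: "real k * \<delta> \<le> c m \<longleftrightarrow> k \<le> ?N" for k
    using \<delta> c_mono[of 0 m] c(1) by (simp add: pos_le_divide_eq[symmetric] le_nat_iff le_floor_iff)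
  have iff: "(\<forall>i\<in>{1..m}. \<forall>k::nat. real k * \<delta> \<le> c i \<longrightarrow> \<bar>x k\<bar> \<le> \<beta> i) \<longleftrightarrow> (\<forall>k\<le>?N. \<bar>x k\<bar> \<le> \<beta> (?i k))"
    for x :: "nat \<Rightarrow> real"
  proof (intro iffI allI ballI impI)
    fix k assume a: "\<forall>i\<in>{1..m}. \<forall>k::nat. real k * \<delta> \<le> c i \<longrightarrow> \<bar>x k\<bar> \<le> \<beta> i" and "k \<le> ?N"
    then have "real k * \<delta> \<le> c m" using N by simp
    then have "real k * \<delta> \<le> c (?i k)" using stage_bounds(3)[OF m, where c=c and s="real k * \<delta>"] by auto
    then show "\<bar>x k\<bar> \<le> \<beta> (?i k)" using a stage_bounds(1,2)[OF m, where c=c and s="real k * \<delta>"] by auto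
  next
    fix i k assume a: "\<forall>k\<le>?N. \<bar>x k\<bar> \<le> \<beta> (?i k)" and i: "i \<in> {1..m}" and k: "real k * \<delta> \<le> c i"
    have "real k * \<delta> \<le> c m" using k c_mono[of i m] i by auto
    then have "\<bar>x k\<bar> \<le> \<beta> (?i k)" using a N by simp
    also have "\<dots> \<le> \<beta> i" using stage_bounds(1)[OF m, where c=c and s="real k * \<delta>"] stage_le[of i "real k * \<delta>" c m] k i
      by (intro \<beta>_mono) auto
    finally show "\<bar>x k\<bar> \<le> \<beta> i" .
  qed
  have "AE \<omega> in M. B 0 \<omega> = 0" using bm by (auto simp: standard_brownian_motion_def)
  then have "AE \<omega> in M. \<omega> \<in> grid_event B m \<beta> c \<delta> \<longleftrightarrow> \<omega> \<in> W.tube (\<lambda>k. \<beta> (?i k)) ?N"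
    by eventually_elim (simp only: grid_event_def W.tube_def S mem_Collect_eq iff diff_zero)
  then show ?thesis
    by (intro finite_measure_eq_AE grid_event_sets[OF bm \<delta>] W.tube_sets) auto
qed

lemma grid_event_lower:
  assumes bm: "standard_brownian_motion B" and \<delta>: "0 < \<delta>" and m: "1 \<le> m"
    and c: "c 0 = 0" "\<And>i. i < m \<Longrightarrow> c i \<le> c (Suc i)"
    and \<beta>: "0 < \<beta> 1" "\<And>i. 1 \<le> i \<Longrightarrow> i < m \<Longrightarrow> \<beta> i \<le> \<beta> (Suc i)"
  shows "exp (- (pi\<^sup>2 / 8 * (\<Sum>i=1..m. 1 / (\<beta> i)\<^sup>2 * (c i - c (i - 1))))) \<le> prob (grid_event B m \<beta> c \<delta>)"
proof -
  let ?N = "nat \<lfloor>c m / \<delta>\<rfloor>" and ?i = "\<lambda>k. stage c m (real k * \<delta>)"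
  define X where "X = (\<lambda>i \<omega>. (B (real (Suc i) * \<delta>) \<omega> - B (real i * \<delta>) \<omega>) / sqrt \<delta>)"
  interpret W: gaussian_walk M X ?N "sqrt \<delta>"
    unfolding X_def by (rule brownian_gaussian_walk[OF bm \<delta>])
  have \<beta>_mono: "\<beta> i \<le> \<beta> j" if "1 \<le> i" "i \<le> j" "j \<le> m" for i j
    by (rule mono_upto[of 1 m \<beta>]) (use \<beta>(2) that in auto)
  have \<beta>_pos: "0 < \<beta> i" if "1 \<le> i" "i \<le> m" for i
    using \<beta>(1) \<beta>_mono[of 1 i] that by simp
  have i: "1 \<le> ?i k" "?i k \<le> m" "?i k \<le> ?i (Suc k)" for k
    using stage_bounds[OF m, where c=c and s="real k * \<delta>"] \<delta> by (auto intro!: stage_mono[OF m])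
  have s: "(\<Sum>k=1..?N. \<delta> * (1 / (\<beta> (?i k))\<^sup>2)) \<le> (\<Sum>i=1..m. 1 / (\<beta> i)\<^sup>2 * (c i - c (i - 1)))"
  proof (rule grid_sum(1)[where d="\<lambda>i. 1 / (\<beta> i)\<^sup>2"])
    show "1 / (\<beta> (Suc i))\<^sup>2 \<le> 1 / (\<beta> i)\<^sup>2" if "1 \<le> i" "i < m" for i
      using \<beta>_pos[of i] \<beta>_pos[of "Suc i"] \<beta>(2)[OF that] that by (intro divide_left_mono power_mono) auto
  qed (use m c \<beta>_pos[of m] \<delta> in auto)
  have "exp (- (pi\<^sup>2 / 8 * (\<Sum>i=1..m. 1 / (\<beta> i)\<^sup>2 * (c i - c (i - 1)))))
     \<le> exp (- (pi\<^sup>2 / 8 * (\<Sum>k=1..?N. (sqrt \<delta>)\<^sup>2 / (\<beta> (?i k))\<^sup>2)))"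
    using s \<delta> by (simp add: mult_left_mono)
  also have "\<dots> \<le> prob (W.tube (\<lambda>k. \<beta> (?i k)) ?N)"
    by (rule W.tube_prob_lower[where r="\<lambda>k. \<beta> (?i k)", OF \<beta>_pos[OF i(1,2)] \<beta>_mono[OF i(1,3,2)]])
  also have "\<dots> = prob (grid_event B m \<beta> c \<delta>)"
    unfolding X_def using prob_grid_event[of B \<delta> m c \<beta>] bm \<delta> m c \<beta> by simp
  finally show ?thesis .
qed

text \<open>The cosines of \<open>tube_prob_upper\<close> are taken wider than the tube by the factor \<open>1 / (1 - \<eta>)\<close>, which gives them the same
  lower bound \<open>\<kappa>\<close> at every stage.  In particular \<open>\<kappa>\<close> does not depend on the scale of \<open>\<beta>\<close>.  The discretisation error
  is the last summand of the exponent, and is linear in \<open>\<delta>\<close>.\<close>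

lemma grid_event_upper:
  assumes bm: "standard_brownian_motion B" and \<delta>: "0 < \<delta>" "\<delta> \<le> 1" and m: "1 \<le> m"
    and c: "c 0 = 0" "\<And>i. i < m \<Longrightarrow> c i \<le> c (Suc i)"
    and \<beta>: "0 < \<beta> 1" "\<And>i. 1 \<le> i \<Longrightarrow> i < m \<Longrightarrow> \<beta> i \<le> \<beta> (Suc i)"
    and \<eta>: "0 < \<eta>" "\<eta> < 1"
  defines "\<kappa> \<equiv> cos ((1 - \<eta>) * (pi / 2))" and "\<gamma> \<equiv> (1 - \<eta>)\<^sup>2 * (pi\<^sup>2 / 8)"
  defines "D \<equiv> 3 / (\<beta> 1 * (\<eta> / (1 - \<eta>))) ^ 4 / \<kappa> * exp (\<gamma> * (1 / (\<beta> 1)\<^sup>2))"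
  shows "prob (grid_event B m \<beta> c \<delta>) \<le> (1 / \<kappa>) ^ m *
    exp (- \<gamma> * (\<Sum>i=1..m. 1 / (\<beta> i)\<^sup>2 * (c i - c (i - 1))) + (\<gamma> * (1 / (\<beta> 1)\<^sup>2) + c m * D) * \<delta>)"
proof -
  let ?N = "nat \<lfloor>c m / \<delta>\<rfloor>" and ?i = "\<lambda>k. stage c m (real k * \<delta>)"
  let ?T = "\<Sum>i=1..m. 1 / (\<beta> i)\<^sup>2 * (c i - c (i - 1))"
  define \<Theta> where "\<Theta> i = (1 - \<eta>) * pi / (2 * \<beta> i)" for i
  define X where "X = (\<lambda>i \<omega>. (B (real (Suc i) * \<delta>) \<omega> - B (real i * \<delta>) \<omega>) / sqrt \<delta>)"
  interpret W: gaussian_walk M X ?N "sqrt \<delta>"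
    unfolding X_def by (rule brownian_gaussian_walk[OF bm \<delta>(1)])
  have \<kappa>: "0 < \<kappa>" "\<kappa> \<le> 1"
  proof -
    have "(1 - \<eta>) * (pi / 2) < 1 * (pi / 2)" "0 < (1 - \<eta>) * (pi / 2)" using \<eta> by (auto intro!: mult_strict_right_mono)
    then show "0 < \<kappa>" unfolding \<kappa>_def by (intro cos_gt_zero) auto
    show "\<kappa> \<le> 1" unfolding \<kappa>_def by simp
  qed
  have \<gamma>: "0 \<le> \<gamma>" unfolding \<gamma>_def by simp
  have \<beta>_mono: "\<beta> i \<le> \<beta> j" if "1 \<le> i" "i \<le> j" "j \<le> m" for i j
    by (rule mono_upto[of 1 m \<beta>]) (use \<beta>(2) that in auto)
  have \<beta>_pos: "0 < \<beta> i" if "1 \<le> i" "i \<le> m" for i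
    using \<beta>(1) \<beta>_mono[of 1 i] that by simp
  have i: "1 \<le> ?i k" "?i k \<le> m" "?i k \<le> ?i (Suc k)" for k
    using stage_bounds[OF m, where c=c and s="real k * \<delta>"] \<delta> by (auto intro!: stage_mono[OF m])
  have cm: "0 \<le> c m"
    using mono_upto[of 0 m c 0 m] c by simp
  have s: "?T - \<delta> * (1 / (\<beta> 1)\<^sup>2) \<le> (\<Sum>k=1..?N. \<delta> * (1 / (\<beta> (?i k))\<^sup>2))"
  proof (rule grid_sum(2)[where d="\<lambda>i. 1 / (\<beta> i)\<^sup>2"])
    show "1 / (\<beta> (Suc i))\<^sup>2 \<le> 1 / (\<beta> i)\<^sup>2" if "1 \<le> i" "i < m" for i
      using \<beta>_pos[of i] \<beta>_pos[of "Suc i"] \<beta>(2)[OF that] that by (intro divide_left_mono power_mono) auto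
  qed (use m c \<beta>_pos[of m] \<delta> in auto)
  let ?\<mu> = "\<lambda>k. exp (- (\<Theta> (?i k) * sqrt \<delta>)\<^sup>2 / 2) + 3 * (sqrt \<delta> / (pi / (2 * \<Theta> (?i k)) - \<beta> (?i k))) ^ 4 / \<kappa>"
  have \<mu>0: "0 \<le> ?\<mu> k" for k using \<kappa> by (intro add_nonneg_nonneg divide_nonneg_nonneg) auto
  have \<mu>: "?\<mu> k \<le> exp (- \<gamma> * (\<delta> * (1 / (\<beta> (?i k))\<^sup>2)) + D * \<delta>\<^sup>2)" for k
  proof -
    let ?b = "\<beta> (?i k)" and ?\<rho> = "\<beta> 1 * (\<eta> / (1 - \<eta>))"
    let ?a = "\<gamma> * (\<delta> * (1 / ?b\<^sup>2))"
    have b: "0 < ?b" "\<beta> 1 \<le> ?b" using i \<beta>_pos \<beta>_mono by auto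
    have \<rho>: "0 < ?\<rho>" using \<eta> \<beta> by simp
    have e: "- (\<Theta> (?i k) * sqrt \<delta>)\<^sup>2 / 2 = - ?a"
      using \<delta> by (simp add: \<Theta>_def \<gamma>_def power_mult_distrib power_divide)
    have "pi / (2 * \<Theta> (?i k)) - ?b = ?b * (\<eta> / (1 - \<eta>))"
      using b \<eta> by (simp add: \<Theta>_def field_simps)
    also have "\<dots> \<ge> ?\<rho>" using b \<eta> by (intro mult_right_mono) auto
    finally have le: "?\<rho> \<le> pi / (2 * \<Theta> (?i k)) - ?b" .
    then have pos: "0 < pi / (2 * \<Theta> (?i k)) - ?b" using \<rho> by linarith
    have "(sqrt \<delta> / (pi / (2 * \<Theta> (?i k)) - ?b)) ^ 4 \<le> (sqrt \<delta> / ?\<rho>) ^ 4"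
      using \<delta> by (intro power_mono divide_left_mono mult_pos_pos le pos \<rho> divide_nonneg_pos) auto
    also have "\<dots> = \<delta>\<^sup>2 / ?\<rho> ^ 4"
    proof -
      have "(sqrt \<delta>) ^ 4 = ((sqrt \<delta>)\<^sup>2)\<^sup>2" by (simp only: power_mult[symmetric]) simp
      then show ?thesis using \<delta> unfolding power_divide by (simp only: real_sqrt_pow2 less_imp_le)
    qed
    finally have "3 * (sqrt \<delta> / (pi / (2 * \<Theta> (?i k)) - ?b)) ^ 4 / \<kappa> \<le> 3 * (\<delta>\<^sup>2 / ?\<rho> ^ 4) / \<kappa>"
      using \<kappa> by (intro divide_right_mono mult_left_mono) auto
    also have "\<dots> = (3 / ?\<rho> ^ 4 / \<kappa> * exp ?a) * \<delta>\<^sup>2 * exp (- ?a)"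
      by (simp add: exp_minus)
    also have "\<dots> \<le> D * \<delta>\<^sup>2 * exp (- ?a)"
    proof (intro mult_right_mono)
      have "\<delta> * (1 / ?b\<^sup>2) \<le> 1 * (1 / (\<beta> 1)\<^sup>2)"
        using b \<beta> \<delta> by (intro mult_mono divide_left_mono power_mono) auto
      from mult_left_mono[OF this \<gamma>] have "?a \<le> \<gamma> * (1 / (\<beta> 1)\<^sup>2)" by (simp only: mult_1_left)
      then show "3 / ?\<rho> ^ 4 / \<kappa> * exp ?a \<le> D"
        unfolding D_def using \<rho> \<kappa> by (intro mult_left_mono) auto
    qed auto
    finally have "?\<mu> k \<le> (1 + D * \<delta>\<^sup>2) * exp (- ?a)" unfolding e by (simp add: algebra_simps)
    also have "\<dots> \<le> exp (D * \<delta>\<^sup>2) * exp (- ?a)" by (intro mult_right_mono) auto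
    also have "\<dots> = exp (- \<gamma> * (\<delta> * (1 / ?b\<^sup>2)) + D * \<delta>\<^sup>2)" by (simp add: exp_add[symmetric])
    finally show ?thesis .
  qed
  have D: "0 \<le> D" unfolding D_def using \<kappa> by (intro mult_nonneg_nonneg divide_nonneg_nonneg) auto
  have "prob (grid_event B m \<beta> c \<delta>) = prob (W.tube (\<lambda>k. \<beta> (?i k)) ?N)"
    unfolding X_def using prob_grid_event[of B \<delta> m c \<beta>] bm \<delta> m c \<beta> by simp
  also have "\<dots> \<le> (1 / \<kappa>) ^ Suc (?i ?N - ?i 0) * (\<Prod>k=1..?N. ?\<mu> k)"
  proof (rule W.tube_prob_upper)
    fix k
    have b: "0 < \<beta> (?i k)" using i \<beta>_pos by simp
    show "?i k \<le> ?i (Suc k)" "0 < \<beta> (?i k)" "0 < \<kappa>" using i b \<kappa> by auto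
    show "\<beta> (?i k) \<le> \<beta> (?i (Suc k))" by (rule \<beta>_mono[OF i(1,3,2)])
    show "0 < \<Theta> (?i k)" using b \<eta> by (simp add: \<Theta>_def)
    show "\<beta> (?i k) < pi / (2 * \<Theta> (?i k))" using b \<eta> by (simp add: \<Theta>_def field_simps)
    show "\<kappa> \<le> cos (\<Theta> (?i k) * \<beta> (?i k))" using b by (simp add: \<Theta>_def \<kappa>_def)
  qed
  also have "\<dots> \<le> (1 / \<kappa>) ^ m * (\<Prod>k=1..?N. exp (- \<gamma> * (\<delta> * (1 / (\<beta> (?i k))\<^sup>2)) + D * \<delta>\<^sup>2))"
  proof (intro mult_mono prod_mono conjI \<mu> \<mu>0 prod_nonneg ballI)
    have "Suc (b - a) \<le> m" if "1 \<le> a" "b \<le> m" for a b using that m by arith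
    from this[OF i(1) i(2)] have "Suc (?i ?N - ?i 0) \<le> m" .
    then show "(1 / \<kappa>) ^ Suc (?i ?N - ?i 0) \<le> (1 / \<kappa>) ^ m" using \<kappa> by (intro power_increasing) auto
  qed (use \<kappa> in auto)
  also have "(\<Prod>k=1..?N. exp (- \<gamma> * (\<delta> * (1 / (\<beta> (?i k))\<^sup>2)) + D * \<delta>\<^sup>2))
     = exp (- \<gamma> * (\<Sum>k=1..?N. \<delta> * (1 / (\<beta> (?i k))\<^sup>2)) + real ?N * \<delta> * (D * \<delta>))"
    by (simp only: exp_sum[symmetric, OF finite_atLeastAtMost] sum.distrib sum_distrib_left[symmetric]
        sum_constant card_atLeastAtMost) (simp add: power2_eq_square mult_ac)
  also have "\<dots> \<le> exp (- \<gamma> * (?T - \<delta> * (1 / (\<beta> 1)\<^sup>2)) + c m * (D * \<delta>))"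
  proof -
    have "real ?N \<le> c m / \<delta>" using cm \<delta> by (simp add: of_nat_floor)
    then have "real ?N * \<delta> \<le> c m" using \<delta> by (simp add: pos_le_divide_eq)
    then have "real ?N * \<delta> * (D * \<delta>) \<le> c m * (D * \<delta>)" using D \<delta> by (intro mult_right_mono) auto
    moreover have "\<gamma> * (?T - \<delta> * (1 / (\<beta> 1)\<^sup>2)) \<le> \<gamma> * (\<Sum>k=1..?N. \<delta> * (1 / (\<beta> (?i k))\<^sup>2))"
      using s \<gamma> by (rule mult_left_mono)
    ultimately show ?thesis by simp
  qed
  finally show ?thesis using \<kappa> by (simp add: algebra_simps)
qed

definition dyadic_event :: "(real \<Rightarrow> 'a \<Rightarrow> real) \<Rightarrow> nat \<Rightarrow> (nat \<Rightarrow> real) \<Rightarrow> (nat \<Rightarrow> real) \<Rightarrow> 'a set" where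
  "dyadic_event B m \<beta> c =
    {\<omega>\<in>space M. \<forall>i\<in>{1..m}. \<forall>n k::nat. real k / 2 ^ n \<le> c i \<longrightarrow> \<bar>B (real k / 2 ^ n) \<omega>\<bar> \<le> \<beta> i}"

lemma grid_event_tendsto:
  assumes bm: "standard_brownian_motion B"
  shows "(\<lambda>n. prob (grid_event B m \<beta> c (1 / 2 ^ n))) \<longlonglongrightarrow> prob (dyadic_event B m \<beta> c)"
proof -
  have "dyadic_event B m \<beta> c = (\<Inter>n. grid_event B m \<beta> c (1 / 2 ^ n))"
    by (auto simp: dyadic_event_def grid_event_def)
  moreover have "decseq (\<lambda>n. grid_event B m \<beta> c (1 / 2 ^ n))"
  proof (rule decseq_SucI, rule subsetI)
    fix n \<omega> assume a: "\<omega> \<in> grid_event B m \<beta> c (1 / 2 ^ Suc n)"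
    have eq: "real k * (1 / 2 ^ n) = real (2 * k) * (1 / 2 ^ Suc n)" for k by simp
    show "\<omega> \<in> grid_event B m \<beta> c (1 / 2 ^ n)"
      unfolding grid_event_def
    proof (intro CollectI conjI ballI allI impI)
      show "\<omega> \<in> space M" using a by (simp add: grid_event_def)
      fix i and k :: nat assume i: "i \<in> {1..m}" and k: "real k * (1 / 2 ^ n) \<le> c i"
      from a i have "real (2 * k) * (1 / 2 ^ Suc n) \<le> c i \<longrightarrow> \<bar>B (real (2 * k) * (1 / 2 ^ Suc n)) \<omega>\<bar> \<le> \<beta> i"
        unfolding grid_event_def by blast
      then show "\<bar>B (real k * (1 / 2 ^ n)) \<omega>\<bar> \<le> \<beta> i" using k unfolding eq by blast
    qed
  qed
  moreover have "range (\<lambda>n. grid_event B m \<beta> c (1 / 2 ^ n)) \<subseteq> sets M"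
    using grid_event_sets[OF bm] by auto
  ultimately show ?thesis using finite_Lim_measure_decseq[of "\<lambda>n. grid_event B m \<beta> c (1 / 2 ^ n)"] by simp
qed

theorem dyadic_event_lower:
  assumes bm: "standard_brownian_motion B" and m: "1 \<le> m"
    and c: "c 0 = 0" "\<And>i. i < m \<Longrightarrow> c i \<le> c (Suc i)"
    and \<beta>: "0 < \<beta> 1" "\<And>i. 1 \<le> i \<Longrightarrow> i < m \<Longrightarrow> \<beta> i \<le> \<beta> (Suc i)"
  shows "exp (- (pi\<^sup>2 / 8 * (\<Sum>i=1..m. 1 / (\<beta> i)\<^sup>2 * (c i - c (i - 1))))) \<le> prob (dyadic_event B m \<beta> c)"
  by (rule LIMSEQ_le_const[OF grid_event_tendsto[OF bm]])
    (intro exI[of _ 0] allI impI grid_event_lower assms; simp)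

theorem dyadic_event_upper:
  assumes bm: "standard_brownian_motion B" and m: "1 \<le> m"
    and c: "c 0 = 0" "\<And>i. i < m \<Longrightarrow> c i \<le> c (Suc i)"
    and \<beta>: "0 < \<beta> 1" "\<And>i. 1 \<le> i \<Longrightarrow> i < m \<Longrightarrow> \<beta> i \<le> \<beta> (Suc i)"
    and \<eta>: "0 < \<eta>" "\<eta> < 1"
  shows "prob (dyadic_event B m \<beta> c) \<le> (1 / cos ((1 - \<eta>) * (pi / 2))) ^ m *
    exp (- ((1 - \<eta>)\<^sup>2 * (pi\<^sup>2 / 8)) * (\<Sum>i=1..m. 1 / (\<beta> i)\<^sup>2 * (c i - c (i - 1))))"
proof (rule LIMSEQ_le[OF grid_event_tendsto[OF bm]])
  let ?T = "\<Sum>i=1..m. 1 / (\<beta> i)\<^sup>2 * (c i - c (i - 1))" and ?\<gamma> = "(1 - \<eta>)\<^sup>2 * (pi\<^sup>2 / 8)" and ?\<kappa> = "cos ((1 - \<eta>) * (pi / 2))"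
  define E where "E = ?\<gamma> * (1 / (\<beta> 1)\<^sup>2) + c m * (3 / (\<beta> 1 * (\<eta> / (1 - \<eta>))) ^ 4 / ?\<kappa> * exp (?\<gamma> * (1 / (\<beta> 1)\<^sup>2)))"
  have "(\<lambda>n. (1 / 2) ^ n :: real) \<longlonglongrightarrow> 0" by (rule LIMSEQ_realpow_zero) auto
  then have "(\<lambda>n. 1 / 2 ^ n :: real) \<longlonglongrightarrow> 0" by (simp add: power_divide)
  then have "(\<lambda>n. (1 / ?\<kappa>) ^ m * exp (- ?\<gamma> * ?T + E * (1 / 2 ^ n))) \<longlonglongrightarrow> (1 / ?\<kappa>) ^ m * exp (- ?\<gamma> * ?T + E * 0)"
    by (intro tendsto_intros)
  then show "(\<lambda>n. (1 / ?\<kappa>) ^ m * exp (- ?\<gamma> * ?T + E * (1 / 2 ^ n))) \<longlonglongrightarrow> (1 / ?\<kappa>) ^ m * exp (- ?\<gamma> * ?T)" by simp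
  show "\<exists>N. \<forall>n\<ge>N. prob (grid_event B m \<beta> c (1 / 2 ^ n)) \<le> (1 / ?\<kappa>) ^ m * exp (- ?\<gamma> * ?T + E * (1 / 2 ^ n))"
    unfolding E_def by (intro exI[of _ 0] allI impI grid_event_upper assms) auto
qed

end

section \<open>Conditioning on the clock\<close>

text \<open>Every point of the interval is a limit of dyadic points below it, and these lie in the interval
  as well.\<close>

lemma abs_le_on_interval_iff_dyadic:
  fixes f :: "real \<Rightarrow> real"
  assumes "continuous_on {0..} f"
  shows "(\<forall>u\<in>{0..c}. \<bar>f u\<bar> \<le> b) \<longleftrightarrow> (\<forall>n k::nat. real k / 2 ^ n \<le> c \<longrightarrow> \<bar>f (real k / 2 ^ n)\<bar> \<le> b)"
proof (intro iffI allI impI ballI)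
  fix u assume *: "\<forall>n k::nat. real k / 2 ^ n \<le> c \<longrightarrow> \<bar>f (real k / 2 ^ n)\<bar> \<le> b" and u: "u \<in> {0..c}"
  define v where "v n = real (nat \<lfloor>u * 2 ^ n\<rfloor>) / 2 ^ n" for n :: nat
  have v: "u - (1 / 2) ^ n \<le> v n" "v n \<le> u" for n
  proof -
    have "real (nat \<lfloor>u * 2 ^ n\<rfloor>) = of_int \<lfloor>u * 2 ^ n\<rfloor>" using u by simp
    then have "real (nat \<lfloor>u * 2 ^ n\<rfloor>) \<le> u * 2 ^ n" "u * 2 ^ n - 1 \<le> real (nat \<lfloor>u * 2 ^ n\<rfloor>)" by linarith+
    then show "v n \<le> u" "u - (1 / 2) ^ n \<le> v n"
      by (auto simp: v_def pos_divide_le_eq pos_le_divide_eq left_diff_distrib power_divide)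
  qed
  have "(\<lambda>n. (1 / 2) ^ n :: real) \<longlonglongrightarrow> 0" by (rule LIMSEQ_realpow_zero) auto
  from tendsto_diff[OF tendsto_const[of u] this] have lim: "(\<lambda>n. u - (1 / 2) ^ n) \<longlonglongrightarrow> u" by simp
  have "v \<longlonglongrightarrow> u" by (rule tendsto_sandwich[OF _ _ lim tendsto_const]) (use v in auto)
  then have "(\<lambda>n. f (v n)) \<longlonglongrightarrow> f u"
    by (rule continuous_on_tendsto_compose[OF assms]) (use u in \<open>auto simp: v_def\<close>)
  then have lim: "(\<lambda>n. \<bar>f (v n)\<bar>) \<longlonglongrightarrow> \<bar>f u\<bar>" by (rule tendsto_rabs)
  have "\<bar>f (v n)\<bar> \<le> b" for n
  proof -
    have "v n \<le> c" using v(2)[of n] u by simp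
    then show ?thesis using * unfolding v_def by blast
  qed
  then show "\<bar>f u\<bar> \<le> b" by (intro LIMSEQ_le_const2[OF lim]) auto
next
  fix n k :: nat assume "\<forall>u\<in>{0..c}. \<bar>f u\<bar> \<le> b" "real k / 2 ^ n \<le> c"
  then show "\<bar>f (real k / 2 ^ n)\<bar> \<le> b" by simp
qed

text \<open>By the intermediate value theorem the clock maps \<open>[0, t]\<close> onto \<open>[0, C(t)]\<close>.  The right-hand side involves only countably
  many values of \<open>B\<close>, so it is measurable in the pair of paths.\<close>

lemma running_max_time_changed_le_iff:
  assumes B: "continuous_on {0..} (\<lambda>s. B s \<omega>)" and C: "continuous_on {0..} (\<lambda>s. C s \<omega>)"
    and mono: "mono_on {0..} (\<lambda>s. C s \<omega>)" and C0: "C 0 \<omega> = 0" and t: "0 \<le> t"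
  shows "running_max (time_changed B C) t \<omega> \<le> b \<longleftrightarrow>
    (\<forall>n k::nat. real k / 2 ^ n \<le> C t \<omega> \<longrightarrow> \<bar>B (real k / 2 ^ n) \<omega>\<bar> \<le> b)"
proof -
  have C_mono: "C s \<omega> \<le> C s' \<omega>" if "0 \<le> s" "s \<le> s'" for s s'
    using monotone_onD[OF mono, of s s'] that by simp
  have image: "(\<lambda>s. C s \<omega>) ` {0..t} = {0..C t \<omega>}"
  proof (intro equalityI subsetI)
    fix u assume "u \<in> {0..C t \<omega>}"
    then have "\<exists>s\<ge>0. s \<le> t \<and> C s \<omega> = u"
      using C0 t continuous_on_subset[OF C, of "{0..t}"] by (intro IVT') auto
    then show "u \<in> (\<lambda>s. C s \<omega>) ` {0..t}" by auto
  qed (use C_mono C0 C_mono[of 0] in auto)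
  have "running_max (time_changed B C) t \<omega> = (SUP u\<in>{0..C t \<omega>}. \<bar>B u \<omega>\<bar>)"
    unfolding running_max_def time_changed_def image[symmetric] image_image ..
  moreover have "bdd_above ((\<lambda>u. \<bar>B u \<omega>\<bar>) ` {0..C t \<omega>})"
    by (intro bounded_imp_bdd_above compact_imp_bounded compact_continuous_image continuous_on_rabs
        continuous_on_subset[OF B]) auto
  moreover have "0 \<le> C t \<omega>" using C_mono[of 0 t] C0 t by simp
  ultimately have "running_max (time_changed B C) t \<omega> \<le> b \<longleftrightarrow> (\<forall>u\<in>{0..C t \<omega>}. \<bar>B u \<omega>\<bar> \<le> b)"
    by (simp add: cSUP_le_iff)
  also note abs_le_on_interval_iff_dyadic[OF B]
  finally show ?thesis .
qed

lemma times_nonneg: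
  fixes t :: "nat \<Rightarrow> real"
  assumes "t 0 = 0" "\<And>i. i < m \<Longrightarrow> t i < t (Suc i)" "i \<le> m"
  shows "0 \<le> t i"
  using mono_upto[of 0 m t 0 i] assms by (simp add: less_imp_le)

text \<open>The functional of the clock that the clock assumption controls.\<close>

definition weighted_clock ::
    "(real \<Rightarrow> 'a \<Rightarrow> real) \<Rightarrow> nat \<Rightarrow> (nat \<Rightarrow> real) \<Rightarrow> (nat \<Rightarrow> real) \<Rightarrow> 'a \<Rightarrow> real" where
  "weighted_clock C m t d \<omega> = (\<Sum>i=1..m. d i * (C (t i) \<omega> - C (t (i - 1)) \<omega>))"

context prob_space begin

context
  fixes C :: "real \<Rightarrow> 'a \<Rightarrow> real" and m :: nat and t :: "nat \<Rightarrow> real"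
  assumes clock: "clock_process C" and t0: "t 0 = 0" and t: "\<And>i. i < m \<Longrightarrow> t i < t (Suc i)"
begin

lemma clock_at_times:
  assumes "\<omega> \<in> space M"
  shows "C (t 0) \<omega> = 0" "i < m \<Longrightarrow> C (t i) \<omega> \<le> C (t (Suc i)) \<omega>"
proof -
  show "C (t 0) \<omega> = 0" using clock assms t0 by (simp add: clock_process_def)
  assume "i < m"
  then show "C (t i) \<omega> \<le> C (t (Suc i)) \<omega>"
    using times_nonneg[of t m i, OF t0 t] less_imp_le[OF t[of i]] monotone_onD[of "{0..}" "(\<le>)" "(\<le>)" "\<lambda>s. C s \<omega>" "t i" "t (Suc i)"] clock assms
    unfolding clock_process_def by simp
qed

lemma weighted_clock_nonneg:
  assumes "\<omega> \<in> space M" "\<And>i. i \<in> {1..m} \<Longrightarrow> 0 \<le> d i"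
  shows "0 \<le> weighted_clock C m t d \<omega>"
  unfolding weighted_clock_def
proof (intro sum_nonneg mult_nonneg_nonneg assms(2))
  fix i assume "i \<in> {1..m}"
  then show "0 \<le> C (t i) \<omega> - C (t (i - 1)) \<omega>" using clock_at_times(2)[OF assms(1), of "i - 1"] by (cases i) auto
qed

lemma borel_measurable_weighted_clock: "weighted_clock C m t d \<in> borel_measurable M"
  unfolding weighted_clock_def
  by (intro borel_measurable_sum borel_measurable_times borel_measurable_const borel_measurable_diff)
    (use clock times_nonneg[of t m] t0 t in \<open>auto simp: clock_process_def\<close>)

lemma integrable_exp_weighted_clock:
  assumes "0 \<le> \<gamma>" "\<And>i. i \<in> {1..m} \<Longrightarrow> 0 \<le> d i"
  shows "integrable M (\<lambda>\<omega>. exp (- \<gamma> * weighted_clock C m t d \<omega>))"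
proof (rule integrable_const_bound[where B=1])
  show "AE \<omega> in M. norm (exp (- \<gamma> * weighted_clock C m t d \<omega>)) \<le> 1"
    using weighted_clock_nonneg[OF _ assms(2)] assms(1) by (intro AE_I2) simp
qed (use borel_measurable_weighted_clock[measurable] in measurable)

end

lemma indep_var_nn_integral_swap:
  assumes "indep_var S X T Y" and [measurable]: "G \<in> borel_measurable (S \<Otimes>\<^sub>M T)"
  shows "(\<integral>\<^sup>+\<omega>. G (X \<omega>, Y \<omega>) \<partial>M) = (\<integral>\<^sup>+\<omega>'. (\<integral>\<^sup>+\<omega>. G (X \<omega>, Y \<omega>') \<partial>M) \<partial>M)"
proof -
  have [measurable]: "X \<in> measurable M S" "Y \<in> measurable M T"
    using assms(1) by (auto simp: indep_var_distribution_eq)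
  interpret pair_sigma_finite M M ..
  have "(\<lambda>(\<omega>, \<omega>'). G (X \<omega>, Y \<omega>')) \<in> borel_measurable (M \<Otimes>\<^sub>M M)" by measurable
  from Fubini'[OF this] show ?thesis using indep_var_nn_integral[OF assms] by simp
qed

definition small_max_event ::
    "(real \<Rightarrow> 'a \<Rightarrow> real) \<Rightarrow> (real \<Rightarrow> 'a \<Rightarrow> real) \<Rightarrow> nat \<Rightarrow> (nat \<Rightarrow> real) \<Rightarrow> (nat \<Rightarrow> real) \<Rightarrow> 'a set" where
  "small_max_event B C m t \<beta> = {\<omega>\<in>space M. \<forall>i\<in>{1..m}. running_max (time_changed B C) (t i) \<omega> \<le> \<beta> i}"

context
  fixes B C :: "real \<Rightarrow> 'a \<Rightarrow> real"
  assumes bm: "standard_brownian_motion B" and clock: "clock_process C"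
begin

lemma running_max_le_iff:
  assumes "\<omega> \<in> space M" "0 \<le> t"
  shows "running_max (time_changed B C) t \<omega> \<le> b \<longleftrightarrow>
    (\<forall>n k::nat. real k / 2 ^ n \<le> C t \<omega> \<longrightarrow> \<bar>B (real k / 2 ^ n) \<omega>\<bar> \<le> b)"
  using bm clock assms unfolding standard_brownian_motion_def clock_process_def
  by (intro running_max_time_changed_le_iff) auto

lemma borel_measurable_running_max:
  assumes "0 \<le> t" shows "running_max (time_changed B C) t \<in> borel_measurable M"
proof (subst borel_measurable_iff_le, intro allI)
  fix b
  have [measurable]: "B (real k / 2 ^ n) \<in> borel_measurable M" for k n :: nat
    using bm by (auto simp: standard_brownian_motion_def)
  have [measurable]: "C t \<in> borel_measurable M"
    using clock assms by (auto simp: clock_process_def)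
  have "{\<omega> \<in> space M. running_max (time_changed B C) t \<omega> \<le> b}
    = {\<omega> \<in> space M. \<forall>n k::nat. real k / 2 ^ n \<le> C t \<omega> \<longrightarrow> \<bar>B (real k / 2 ^ n) \<omega>\<bar> \<le> b}"
    using running_max_le_iff[OF _ assms] by blast
  also have "\<dots> \<in> sets M" by measurable
  finally show "{\<omega> \<in> space M. running_max (time_changed B C) t \<omega> \<le> b} \<in> sets M" .
qed

lemma small_max_event_sets:
  assumes "\<And>i. i \<le> m \<Longrightarrow> 0 \<le> t i" shows "small_max_event B C m t \<beta> \<in> sets M"
  unfolding small_max_event_def
  by (intro sets.sets_Collect_finite_All) (use assms borel_measurable_running_max in auto)

text \<open>Conditioning on the clock: by independence the clock may be frozen while the Brownian path is
  integrated out.\<close>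

lemma emeasure_small_max_event:
  assumes indep: "independent_processes B C" and t: "\<And>i. i \<le> m \<Longrightarrow> 0 \<le> t i"
  shows "emeasure M (small_max_event B C m t \<beta>) = (\<integral>\<^sup>+\<omega>. ennreal (prob (dyadic_event B m \<beta> (\<lambda>i. C (t i) \<omega>))) \<partial>M)"
proof -
  let ?P = "PiM {0..} (\<lambda>_. borel) :: (real \<Rightarrow> real) measure"
  let ?B = "\<lambda>\<omega>. \<lambda>s\<in>{0..}. B s \<omega>" and ?C = "\<lambda>\<omega>. \<lambda>s\<in>{0..}. C s \<omega>"
  let ?Q = "\<lambda>x y. \<forall>i\<in>{1..m}. \<forall>n k::nat. real k / 2 ^ n \<le> y (t i) \<longrightarrow> \<bar>x (real k / 2 ^ n)\<bar> \<le> \<beta> i"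
  define G :: "(real \<Rightarrow> real) \<times> (real \<Rightarrow> real) \<Rightarrow> ennreal" where "G = indicator {p. ?Q (fst p) (snd p)}"
  have ind: "indep_var ?P ?B ?P ?C" using indep unfolding independent_processes_def .
  have "{p \<in> space (?P \<Otimes>\<^sub>M ?P). ?Q (fst p) (snd p)} \<in> sets (?P \<Otimes>\<^sub>M ?P)"
  proof (rule sets.sets_Collect_finite_All)
    fix i assume i: "i \<in> {1..m}"
    have [measurable]: "(\<lambda>p. snd p (t i)) \<in> borel_measurable (?P \<Otimes>\<^sub>M ?P)"
      by (rule measurable_compose[OF measurable_snd measurable_component_singleton]) (use t i in auto)
    have [measurable]: "(\<lambda>p. fst p (real k / 2 ^ n)) \<in> borel_measurable (?P \<Otimes>\<^sub>M ?P)" for k n :: nat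
      by (rule measurable_compose[OF measurable_fst measurable_component_singleton]) auto
    show "{p \<in> space (?P \<Otimes>\<^sub>M ?P). \<forall>n k::nat. real k / 2 ^ n \<le> snd p (t i) \<longrightarrow> \<bar>fst p (real k / 2 ^ n)\<bar> \<le> \<beta> i} \<in> sets (?P \<Otimes>\<^sub>M ?P)"
      by measurable
  qed simp
  then have G: "G \<in> borel_measurable (?P \<Otimes>\<^sub>M ?P)"
    unfolding G_def by (simp add: borel_measurable_indicator_iff Int_def conj_commute)
  have GBC: "G (?B \<omega>, ?C \<omega>') = indicator (dyadic_event B m \<beta> (\<lambda>i. C (t i) \<omega>')) \<omega>" if "\<omega> \<in> space M" for \<omega> \<omega>'
    using that t by (auto simp: G_def dyadic_event_def indicator_def)
  have "emeasure M (small_max_event B C m t \<beta>) = (\<integral>\<^sup>+\<omega>. indicator (small_max_event B C m t \<beta>) \<omega> \<partial>M)"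
    using small_max_event_sets[OF t] by simp
  also have "\<dots> = (\<integral>\<^sup>+\<omega>. G (?B \<omega>, ?C \<omega>) \<partial>M)"
  proof (rule nn_integral_cong)
    fix \<omega> assume \<omega>: "\<omega> \<in> space M"
    then have "\<omega> \<in> small_max_event B C m t \<beta> \<longleftrightarrow> \<omega> \<in> dyadic_event B m \<beta> (\<lambda>i. C (t i) \<omega>)"
      using t by (auto simp: small_max_event_def dyadic_event_def running_max_le_iff[OF \<omega>])
    then show "indicator (small_max_event B C m t \<beta>) \<omega> = G (?B \<omega>, ?C \<omega>)"
      unfolding GBC[OF \<omega>] by (simp add: indicator_def)
  qed
  also have "\<dots> = (\<integral>\<^sup>+\<omega>'. \<integral>\<^sup>+\<omega>. G (?B \<omega>, ?C \<omega>') \<partial>M \<partial>M)"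
    by (rule indep_var_nn_integral_swap[OF ind G])
  also have "\<dots> = (\<integral>\<^sup>+\<omega>'. \<integral>\<^sup>+\<omega>. indicator (dyadic_event B m \<beta> (\<lambda>i. C (t i) \<omega>')) \<omega> \<partial>M \<partial>M)"
    by (intro nn_integral_cong) (simp only: GBC)
  also have "\<dots> = (\<integral>\<^sup>+\<omega>. ennreal (prob (dyadic_event B m \<beta> (\<lambda>i. C (t i) \<omega>))) \<partial>M)"
  proof -
    have "dyadic_event B m \<beta> c \<in> sets M" for c
    proof -
      have [measurable]: "B (real k / 2 ^ n) \<in> borel_measurable M" for k n :: nat
        using bm by (auto simp: standard_brownian_motion_def)
      show ?thesis unfolding dyadic_event_def by measurable
    qed
    then show ?thesis by (simp add: emeasure_eq_measure)
  qed
  finally show ?thesis .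
qed

context
  fixes m :: nat and t \<beta> :: "nat \<Rightarrow> real"
  assumes indep: "independent_processes B C" and m: "1 \<le> m" and t0: "t 0 = 0" and t: "\<And>i. i < m \<Longrightarrow> t i < t (Suc i)"
    and \<beta>: "0 < \<beta> 1" "\<And>i. 1 \<le> i \<Longrightarrow> i < m \<Longrightarrow> \<beta> i \<le> \<beta> (Suc i)"
begin

lemma small_max_event_lower:
  "expectation (\<lambda>\<omega>. exp (- (pi\<^sup>2 / 8) * weighted_clock C m t (\<lambda>i. 1 / (\<beta> i)\<^sup>2) \<omega>)) \<le> prob (small_max_event B C m t \<beta>)"
proof -
  let ?X = "weighted_clock C m t (\<lambda>i. 1 / (\<beta> i)\<^sup>2)"
  have "ennreal (expectation (\<lambda>\<omega>. exp (- (pi\<^sup>2 / 8) * ?X \<omega>))) = (\<integral>\<^sup>+\<omega>. ennreal (exp (- (pi\<^sup>2 / 8) * ?X \<omega>)) \<partial>M)"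
    by (intro nn_integral_eq_integral[symmetric] integrable_exp_weighted_clock[OF clock t0 t]) auto
  also have "\<dots> \<le> (\<integral>\<^sup>+\<omega>. ennreal (prob (dyadic_event B m \<beta> (\<lambda>i. C (t i) \<omega>))) \<partial>M)"
  proof (rule nn_integral_mono)
    fix \<omega> assume "\<omega> \<in> space M"
    from dyadic_event_lower[where c="\<lambda>i. C (t i) \<omega>", OF bm m clock_at_times[where C=C and t=t and m=m, OF clock t0 t this] \<beta>]
    show "ennreal (exp (- (pi\<^sup>2 / 8) * ?X \<omega>)) \<le> ennreal (prob (dyadic_event B m \<beta> (\<lambda>i. C (t i) \<omega>)))"
      by (intro ennreal_leI) (simp add: weighted_clock_def)
  qed
  also have "\<dots> = ennreal (prob (small_max_event B C m t \<beta>))"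
    using emeasure_small_max_event[OF indep, of m t \<beta>] times_nonneg[of t m] t0 t by (simp add: emeasure_eq_measure)
  finally show ?thesis by (simp only: ennreal_le_iff[OF measure_nonneg])
qed

lemma small_max_event_upper:
  assumes \<eta>: "0 < \<eta>" "\<eta> < 1"
  shows "prob (small_max_event B C m t \<beta>) \<le> (1 / cos ((1 - \<eta>) * (pi / 2))) ^ m *
    expectation (\<lambda>\<omega>. exp (- ((1 - \<eta>)\<^sup>2 * (pi\<^sup>2 / 8)) * weighted_clock C m t (\<lambda>i. 1 / (\<beta> i)\<^sup>2) \<omega>))"
proof -
  let ?X = "weighted_clock C m t (\<lambda>i. 1 / (\<beta> i)\<^sup>2)" and ?\<gamma> = "(1 - \<eta>)\<^sup>2 * (pi\<^sup>2 / 8)"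
  let ?\<kappa> = "(1 / cos ((1 - \<eta>) * (pi / 2))) ^ m"
  have "0 < cos ((1 - \<eta>) * (pi / 2))"
  proof (rule cos_gt_zero)
    show "(1 - \<eta>) * (pi / 2) < pi / 2" "0 < (1 - \<eta>) * (pi / 2)" using \<eta> by auto
  qed
  then have \<kappa>: "0 \<le> ?\<kappa>" by simp
  have "ennreal (prob (small_max_event B C m t \<beta>)) = (\<integral>\<^sup>+\<omega>. ennreal (prob (dyadic_event B m \<beta> (\<lambda>i. C (t i) \<omega>))) \<partial>M)"
    using emeasure_small_max_event[OF indep, of m t \<beta>] times_nonneg[of t m] t0 t by (simp add: emeasure_eq_measure)
  also have "\<dots> \<le> (\<integral>\<^sup>+\<omega>. ennreal (?\<kappa> * exp (- ?\<gamma> * ?X \<omega>)) \<partial>M)"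
  proof (rule nn_integral_mono)
    fix \<omega> assume "\<omega> \<in> space M"
    from dyadic_event_upper[where c="\<lambda>i. C (t i) \<omega>", OF bm m clock_at_times[where C=C and t=t and m=m, OF clock t0 t this] \<beta> \<eta>]
    show "ennreal (prob (dyadic_event B m \<beta> (\<lambda>i. C (t i) \<omega>))) \<le> ennreal (?\<kappa> * exp (- ?\<gamma> * ?X \<omega>))"
      unfolding weighted_clock_def by (rule ennreal_leI)
  qed
  also have "\<dots> = ennreal (expectation (\<lambda>\<omega>. ?\<kappa> * exp (- ?\<gamma> * ?X \<omega>)))"
    using \<kappa> by (intro nn_integral_eq_integral integrable_mult_right integrable_exp_weighted_clock[OF clock t0 t]) auto
  finally have "prob (small_max_event B C m t \<beta>) \<le> expectation (\<lambda>\<omega>. ?\<kappa> * exp (- ?\<gamma> * ?X \<omega>))"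
    using \<kappa> by (subst (asm) ennreal_le_iff) (auto intro!: integral_nonneg_AE)
  then show ?thesis by (simp only: integral_mult_right_zero)
qed

end

end

end

section \<open>Laplace principle and change of scale\<close>

text \<open>The minimum of \<open>\<gamma> y + k y\<^sup>-\<^sup>\<alpha>\<close> over \<open>y > 0\<close>.\<close>

definition laplace_exponent :: "real \<Rightarrow> real \<Rightarrow> real \<Rightarrow> real" where
  "laplace_exponent \<alpha> k \<gamma> = (1 + \<alpha>) * \<alpha> powr (- \<alpha> / (1 + \<alpha>)) * k powr (1 / (1 + \<alpha>)) * \<gamma> powr (\<alpha> / (1 + \<alpha>))"

lemma laplace_exponent_minimum:
  assumes "0 < \<alpha>" "0 < k" "0 < \<gamma>"
  shows "\<exists>y>0. \<gamma> * y + k * y powr (- \<alpha>) = laplace_exponent \<alpha> k \<gamma>"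
    and "0 < y \<Longrightarrow> laplace_exponent \<alpha> k \<gamma> \<le> \<gamma> * y + k * y powr (- \<alpha>)"
proof -
  define z where "z = (\<alpha> * k / \<gamma>) powr (1 / (1 + \<alpha>))"
  have z: "0 < z" using assms by (simp add: z_def)
  have "z powr (1 + \<alpha>) = \<alpha> * k / \<gamma>" using assms by (simp add: z_def powr_powr)
  then have "z powr (- \<alpha>) * (\<alpha> * k / \<gamma>) = z"
    using z powr_add[of z "- \<alpha>" "1 + \<alpha>"] by simp
  then have kz: "k * z powr (- \<alpha>) = \<gamma> * z / \<alpha>"
    using assms by (simp add: field_simps)
  have "z = \<alpha> powr (1 / (1 + \<alpha>)) * k powr (1 / (1 + \<alpha>)) * \<gamma> powr (- (1 / (1 + \<alpha>)))"
    using assms by (simp add: z_def powr_divide powr_mult powr_minus divide_simps)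
  moreover have "\<gamma> * \<gamma> powr (- (1 / (1 + \<alpha>))) = \<gamma> powr (\<alpha> / (1 + \<alpha>))"
  proof -
    have "1 + - (1 / (1 + \<alpha>)) = \<alpha> / (1 + \<alpha>)" using assms by (simp add: field_simps)
    then show ?thesis using assms powr_add[of \<gamma> 1 "- (1 / (1 + \<alpha>))"] by simp
  qed
  moreover have "\<alpha> powr (1 / (1 + \<alpha>)) = \<alpha> * \<alpha> powr (- \<alpha> / (1 + \<alpha>))"
  proof -
    have "1 + (- \<alpha> / (1 + \<alpha>)) = 1 / (1 + \<alpha>)" using assms by (simp add: field_simps)
    then show ?thesis using assms powr_add[of \<alpha> 1 "- \<alpha> / (1 + \<alpha>)"] by simp
  qed
  ultimately have gz: "\<gamma> * z = \<alpha> * (\<alpha> powr (- \<alpha> / (1 + \<alpha>)) * k powr (1 / (1 + \<alpha>)) * \<gamma> powr (\<alpha> / (1 + \<alpha>)))"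
    by (metis (no_types, opaque_lifting) mult.assoc mult.commute)
  have A: "laplace_exponent \<alpha> k \<gamma> = \<gamma> * z / \<alpha> * (1 + \<alpha>)"
    unfolding laplace_exponent_def gz using assms by simp
  have "\<gamma> * z + k * z powr (- \<alpha>) = laplace_exponent \<alpha> k \<gamma>"
    unfolding A kz using assms by (simp add: field_simps)
  then show "\<exists>y>0. \<gamma> * y + k * y powr (- \<alpha>) = laplace_exponent \<alpha> k \<gamma>" using z by blast
  assume y: "0 < y"
  define u where "u = y / z"
  have u: "0 < u" "y = z * u" using y z by (auto simp: u_def)
  \<comment> \<open>After rescaling by the minimiser \<open>z\<close>, minimality reduces to \<open>1 + \<alpha> \<le> \<alpha> u + u\<^sup>-\<^sup>\<alpha>\<close>.\<close>
  have "1 - \<alpha> * (u - 1) \<le> 1 + - \<alpha> * ln u" using ln_le_minus_one[OF u(1)] assms by simp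
  also have "\<dots> \<le> u powr (- \<alpha>)" using exp_ge_add_one_self[of "- \<alpha> * ln u"] u by (simp add: powr_def)
  finally have "1 + \<alpha> \<le> \<alpha> * u + u powr (- \<alpha>)" by (simp add: algebra_simps)
  then have "\<gamma> * z / \<alpha> * (1 + \<alpha>) \<le> \<gamma> * z / \<alpha> * (\<alpha> * u + u powr (- \<alpha>))"
    using assms z by (intro mult_left_mono) auto
  also have "\<dots> = \<gamma> * (z * u) + \<gamma> * z / \<alpha> * u powr (- \<alpha>)" using assms by (simp add: field_simps)
  also have "\<dots> = \<gamma> * y + k * y powr (- \<alpha>)"
    unfolding kz[symmetric] u(2) using z u by (simp add: powr_mult)
  finally show "laplace_exponent \<alpha> k \<gamma> \<le> \<gamma> * y + k * y powr (- \<alpha>)" unfolding A .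
qed

lemma laplace_exponent_pos: "0 < \<alpha> \<Longrightarrow> 0 < k \<Longrightarrow> 0 < \<gamma> \<Longrightarrow> 0 < laplace_exponent \<alpha> k \<gamma>"
  by (simp add: laplace_exponent_def)

text \<open>As \<open>ln 0 = 0\<close>, a nonzero limit rules out that \<open>p\<close> vanishes.\<close>

lemma eventually_pos_of_log_rate:
  fixes p L :: "'b \<Rightarrow> real"
  assumes lim: "((\<lambda>\<epsilon>. ln (p \<epsilon>) / L \<epsilon>) \<longlongrightarrow> - V) F" and "0 < V" and "\<And>\<epsilon>. 0 \<le> p \<epsilon>"
  shows "\<forall>\<^sub>F \<epsilon> in F. 0 < p \<epsilon>"
proof -
  have "- V < 0" using \<open>0 < V\<close> by simp
  from order_tendstoD(2)[OF lim this] show ?thesis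
  proof eventually_elim
    case (elim \<epsilon>)
    then have "p \<epsilon> \<noteq> 0" by auto
    then show ?case using assms(3)[of \<epsilon>] by simp
  qed
qed

lemma exp_neg_le_step_function:
  fixes X :: real
  assumes "0 \<le> X" "0 \<le> c"
  shows "exp (- c * X) \<le> (\<Sum>j<n. exp (- c * (real j * h)) * indicator {..real (Suc j) * h} X) + exp (- c * (real n * h))"
proof (induction n)
  case 0
  then show ?case using assms by simp
next
  case (Suc n)
  show ?case
  proof (cases "X \<le> real (Suc n) * h")
    case True
    then show ?thesis using Suc by (simp add: add_increasing2)
  next
    case False
    then have "c * (real (Suc n) * h) \<le> c * X" using assms by (intro mult_left_mono) auto
    then have "exp (- c * X) \<le> exp (- c * (real (Suc n) * h))" by simp
    moreover have "0 \<le> (\<Sum>j<Suc n. exp (- c * (real j * h)) * indicator {..real (Suc j) * h} X)"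
      by (intro sum_nonneg) auto
    ultimately show ?thesis by linarith
  qed
qed

text \<open>Laplace's principle for \<open>Y = X / x\<close>, whose lower tail is \<open>exp (- L k y\<^sup>-\<^sup>\<alpha>)\<close> on the logarithmic scale.  For the lower bound,
  the expectation is restricted to \<open>Y \<le> y\<close> with the minimising \<open>y\<close>.  For the upper bound, \<open>exp (- \<gamma> L Y)\<close>
  is dominated by a step function of \<open>Y\<close> with finitely many values: the summand of the cell
  ending at \<open>y\<close> contributes \<open>exp (- L (\<gamma> y + k y\<^sup>-\<^sup>\<alpha>))\<close> up to the width of the cell, and the number of cells is
  lost in the logarithm.\<close>

theorem (in prob_space) laplace_transform_log_rate:
  fixes X :: "'a \<Rightarrow> real" and x L :: "'b \<Rightarrow> real"
  assumes X[measurable]: "X \<in> borel_measurable M" and X0: "\<And>\<omega>. \<omega> \<in> space M \<Longrightarrow> 0 \<le> X \<omega>"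
    and pos: "0 < \<alpha>" "0 < k" "0 < \<gamma>"
    and L: "filterlim L at_top F" and x: "\<forall>\<^sub>F \<epsilon> in F. 0 < x \<epsilon>"
    and rate: "\<And>y. 0 < y \<Longrightarrow> ((\<lambda>\<epsilon>. ln (prob {\<omega>\<in>space M. X \<omega> \<le> y * x \<epsilon>}) / L \<epsilon>) \<longlongrightarrow> - (k * y powr (- \<alpha>))) F"
  shows "((\<lambda>\<epsilon>. ln (expectation (\<lambda>\<omega>. exp (- \<gamma> * (L \<epsilon> / x \<epsilon>) * X \<omega>))) / L \<epsilon>) \<longlongrightarrow> - laplace_exponent \<alpha> k \<gamma>) F"
proof -
  let ?A = "laplace_exponent \<alpha> k \<gamma>"
  let ?p = "\<lambda>y \<epsilon>. prob {\<omega>\<in>space M. X \<omega> \<le> y * x \<epsilon>}"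
  let ?E = "\<lambda>\<epsilon>. expectation (\<lambda>\<omega>. exp (- \<gamma> * (L \<epsilon> / x \<epsilon>) * X \<omega>))"
  have Lpos: "\<forall>\<^sub>F \<epsilon> in F. 0 < L \<epsilon>" using L by (simp add: filterlim_at_top_dense)
  have p_pos: "\<forall>\<^sub>F \<epsilon> in F. 0 < ?p y \<epsilon>" if "0 < y" for y
    using pos that by (intro eventually_pos_of_log_rate[OF rate]) auto
  have int: "integrable M (\<lambda>\<omega>. exp (- c * X \<omega>))" if "0 \<le> c" for c
    by (rule integrable_const_bound[where B=1]) (use X0 that in \<open>auto intro!: AE_I2\<close>)
  have iS: "integrable M (\<lambda>\<omega>. w * indicator {\<omega>\<in>space M. X \<omega> \<le> v} \<omega>)" for w v :: real
    by (intro integrable_mult_right integrable_real_indicator) (auto simp: emeasure_eq_measure)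
  have iSum: "integrable M (\<lambda>\<omega>. (\<Sum>j<n. w j * indicator {\<omega>\<in>space M. X \<omega> \<le> v j} \<omega>) + r)"
    for w v :: "nat \<Rightarrow> real" and n :: nat and r :: real
    by (intro Bochner_Integration.integrable_add Bochner_Integration.integrable_sum iS integrable_const)
  have eSum: "expectation (\<lambda>\<omega>. (\<Sum>j<n. w j * indicator {\<omega>\<in>space M. X \<omega> \<le> v j} \<omega>) + r)
      = (\<Sum>j<n. w j * prob {\<omega>\<in>space M. X \<omega> \<le> v j}) + r"
    for w v :: "nat \<Rightarrow> real" and n :: nat and r :: real
  proof -
    have "expectation (\<lambda>\<omega>. w j * indicator {\<omega>\<in>space M. X \<omega> \<le> v j} \<omega>) = w j * prob {\<omega>\<in>space M. X \<omega> \<le> v j}" for j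
      by simp
    then show ?thesis
      by (simp only: Bochner_Integration.integral_add[OF Bochner_Integration.integrable_sum[OF iS] integrable_const]
          Bochner_Integration.integral_sum[OF iS] lebesgue_integral_const prob_space) simp
  qed
  have small: "((\<lambda>\<epsilon>. c / L \<epsilon>) \<longlongrightarrow> 0) F" for c
    using tendsto_divide_0[OF tendsto_const filterlim_at_top_imp_at_infinity[OF L]] .
  obtain y where y: "0 < y" "\<gamma> * y + k * y powr (- \<alpha>) = ?A"
    using laplace_exponent_minimum(1)[OF pos] by blast
  have lower: "\<forall>\<^sub>F \<epsilon> in F. 0 < ?E \<epsilon> \<and> - \<gamma> * y + ln (?p y \<epsilon>) / L \<epsilon> \<le> ln (?E \<epsilon>) / L \<epsilon>"
    using Lpos x p_pos[OF y(1)]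
  proof eventually_elim
    case (elim \<epsilon>)
    let ?c = "\<gamma> * (L \<epsilon> / x \<epsilon>)" and ?S = "{\<omega>\<in>space M. X \<omega> \<le> y * x \<epsilon>}"
    have c: "0 \<le> ?c" using elim pos by simp
    have "exp (- \<gamma> * y * L \<epsilon>) * ?p y \<epsilon> = expectation (\<lambda>\<omega>. exp (- \<gamma> * y * L \<epsilon>) * indicator ?S \<omega>)"
      by simp
    also have "\<dots> \<le> expectation (\<lambda>\<omega>. exp (- ?c * X \<omega>))"
    proof (rule integral_mono)
      fix \<omega> assume "\<omega> \<in> space M"
      have "?c * X \<omega> \<le> \<gamma> * y * L \<epsilon>" if "\<omega> \<in> ?S"
        using that mult_left_mono[of "X \<omega>" "y * x \<epsilon>" ?c] c elim by (simp add: mult_ac)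
      then show "exp (- \<gamma> * y * L \<epsilon>) * indicator ?S \<omega> \<le> exp (- ?c * X \<omega>)"
        by (auto simp: indicator_def)
    qed (use int[OF c] in \<open>auto intro!: integrable_real_indicator simp: emeasure_eq_measure\<close>)
    finally have le: "exp (- \<gamma> * y * L \<epsilon>) * ?p y \<epsilon> \<le> ?E \<epsilon>" by simp
    moreover have "0 < exp (- \<gamma> * y * L \<epsilon>) * ?p y \<epsilon>" using elim by simp
    ultimately have E: "0 < ?E \<epsilon>" by linarith
    have "- \<gamma> * y * L \<epsilon> + ln (?p y \<epsilon>) = ln (exp (- \<gamma> * y * L \<epsilon>) * ?p y \<epsilon>)"
      using elim by (simp add: ln_mult)
    also have "\<dots> \<le> ln (?E \<epsilon>)" using le elim E by (subst ln_le_cancel_iff) auto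
    finally have "(- \<gamma> * y * L \<epsilon> + ln (?p y \<epsilon>)) / L \<epsilon> \<le> ln (?E \<epsilon>) / L \<epsilon>"
      using elim by (intro divide_right_mono) auto
    moreover have "(- \<gamma> * y * L \<epsilon> + ln (?p y \<epsilon>)) / L \<epsilon> = - \<gamma> * y + ln (?p y \<epsilon>) / L \<epsilon>"
      using elim by (simp add: field_simps)
    ultimately show ?case using E by simp
  qed
  show ?thesis
  proof (rule order_tendstoI)
    fix l assume l: "l < - ?A"
    have "((\<lambda>\<epsilon>. - \<gamma> * y + ln (?p y \<epsilon>) / L \<epsilon>) \<longlongrightarrow> - \<gamma> * y + - (k * y powr (- \<alpha>))) F"
      by (intro tendsto_intros rate y)
    moreover have "l < - \<gamma> * y + - (k * y powr (- \<alpha>))" using l y(2) by simp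
    ultimately have "\<forall>\<^sub>F \<epsilon> in F. l < - \<gamma> * y + ln (?p y \<epsilon>) / L \<epsilon>" by (rule order_tendstoD(1))
    with lower show "\<forall>\<^sub>F \<epsilon> in F. l < ln (?E \<epsilon>) / L \<epsilon>" by eventually_elim linarith
  next
    fix u assume u: "- ?A < u"
    define e where "e = (u + ?A) / 3"
    have e: "0 < e" using u by (simp add: e_def)
    define h where "h = e / \<gamma>"
    have h: "0 < h" "\<gamma> * h = e" using e pos by (auto simp: h_def)
    \<comment> \<open>Beyond \<open>n h\<close> the factor \<open>exp (- \<gamma> L Y)\<close> alone is small enough.\<close>
    obtain n :: nat where n: "?A / (\<gamma> * h) \<le> real n" using real_arch_simple by blast
    then have "?A \<le> real n * (\<gamma> * h)" using h e by (simp add: pos_divide_le_eq)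
    then have n: "?A \<le> \<gamma> * (real n * h)" by (simp only: mult_ac)
    have "\<forall>\<^sub>F \<epsilon> in F. \<forall>j\<in>{..<n}. ln (?p (real (Suc j) * h) \<epsilon>) / L \<epsilon> < - (k * (real (Suc j) * h) powr (- \<alpha>)) + e"
    proof (intro eventually_ball_finite ballI finite_lessThan)
      fix j
      have "0 < real (Suc j) * h" using h by simp
      from order_tendstoD(2)[OF rate[OF this]] show "\<forall>\<^sub>F \<epsilon> in F. ln (?p (real (Suc j) * h) \<epsilon>) / L \<epsilon> < - (k * (real (Suc j) * h) powr (- \<alpha>)) + e"
        using e by simp
    qed
    moreover have "\<forall>\<^sub>F \<epsilon> in F. \<forall>j\<in>{..<n}. 0 < ?p (real (Suc j) * h) \<epsilon>"
      using h by (intro eventually_ball_finite ballI finite_lessThan p_pos) auto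
    moreover have "\<forall>\<^sub>F \<epsilon> in F. ln (real (Suc n)) / L \<epsilon> < e"
      using order_tendstoD(2)[OF small e] .
    ultimately show "\<forall>\<^sub>F \<epsilon> in F. ln (?E \<epsilon>) / L \<epsilon> < u"
      using Lpos x lower
    proof eventually_elim
      case (elim \<epsilon>)
      let ?c = "\<gamma> * (L \<epsilon> / x \<epsilon>)" and ?b = "exp (L \<epsilon> * (- ?A + 2 * e))"
      have c: "0 \<le> ?c" using elim pos by simp
      have cx: "?c * (r * x \<epsilon>) = L \<epsilon> * (\<gamma> * r)" for r using elim by simp
      have "?E \<epsilon> = expectation (\<lambda>\<omega>. exp (- ?c * X \<omega>))" by simp
      also have "\<dots> \<le> expectation (\<lambda>\<omega>. (\<Sum>j<n. exp (- ?c * (real j * (h * x \<epsilon>))) * indicator {\<omega>\<in>space M. X \<omega> \<le> real (Suc j) * h * x \<epsilon>} \<omega>)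
          + exp (- ?c * (real n * (h * x \<epsilon>))))"
      proof (rule integral_mono[OF int[OF c]])
        fix \<omega> assume \<omega>: "\<omega> \<in> space M"
        show "exp (- ?c * X \<omega>) \<le> (\<Sum>j<n. exp (- ?c * (real j * (h * x \<epsilon>))) * indicator {\<omega>\<in>space M. X \<omega> \<le> real (Suc j) * h * x \<epsilon>} \<omega>)
          + exp (- ?c * (real n * (h * x \<epsilon>)))"
          using exp_neg_le_step_function[where n=n and h="h * x \<epsilon>", OF X0[OF \<omega>] c] \<omega>
          by (simp add: indicator_def mult.assoc)
      qed (rule iSum)
      also have "\<dots> = (\<Sum>j<n. exp (- ?c * (real j * (h * x \<epsilon>))) * ?p (real (Suc j) * h) \<epsilon>) + exp (- ?c * (real n * (h * x \<epsilon>)))"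
        by (rule eSum)
      also have "\<dots> \<le> (\<Sum>j<n. ?b) + ?b"
      proof (intro add_mono sum_mono)
        fix j assume j: "j \<in> {..<n}"
        let ?y = "real (Suc j) * h"
        have yp: "0 < ?y" using h by simp
        have "ln (?p ?y \<epsilon>) \<le> L \<epsilon> * (- (k * ?y powr (- \<alpha>)) + e)"
          using elim(1) j elim(4) by (auto simp: pos_divide_less_eq mult_ac dest!: bspec[of _ _ j] intro: less_imp_le)
        then have "?p ?y \<epsilon> \<le> exp (L \<epsilon> * (- (k * ?y powr (- \<alpha>)) + e))"
          using elim(2) j by (metis exp_le_cancel_iff exp_ln)
        then have "exp (- ?c * (real j * (h * x \<epsilon>))) * ?p ?y \<epsilon> \<le> exp (- ?c * (real j * (h * x \<epsilon>))) * exp (L \<epsilon> * (- (k * ?y powr (- \<alpha>)) + e))"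
          by (intro mult_left_mono) auto
        also have "\<dots> = exp (L \<epsilon> * (- (\<gamma> * ?y + k * ?y powr (- \<alpha>)) + 2 * e))"
        proof -
          have "- ?c * (real j * (h * x \<epsilon>)) = - (L \<epsilon> * (\<gamma> * (real j * h)))" using cx[of "real j * h"] by (simp add: mult.assoc)
          moreover have "\<gamma> * ?y = \<gamma> * (real j * h) + e" using h(2) by (simp add: algebra_simps)
          ultimately show ?thesis by (simp add: exp_add[symmetric] algebra_simps)
        qed
        also have "\<dots> \<le> ?b"
          using laplace_exponent_minimum(2)[OF pos yp] elim by (simp add: mult_left_mono)
        finally show "exp (- ?c * (real j * (h * x \<epsilon>))) * ?p ?y \<epsilon> \<le> ?b" .
      next
        have "- ?c * (real n * (h * x \<epsilon>)) = - (L \<epsilon> * (\<gamma> * (real n * h)))" using cx[of "real n * h"] by (simp add: mult.assoc)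
        also have "\<dots> = L \<epsilon> * (- (\<gamma> * (real n * h)))" by simp
        also have "\<dots> \<le> L \<epsilon> * (- ?A + 2 * e)" using n e elim by (intro mult_left_mono) auto
        finally show "exp (- ?c * (real n * (h * x \<epsilon>))) \<le> ?b" by simp
      qed
      also have "\<dots> = real (Suc n) * ?b" by (simp add: algebra_simps)
      finally have "ln (?E \<epsilon>) \<le> ln (real (Suc n) * ?b)" using elim by (subst ln_le_cancel_iff) auto
      also have "\<dots> = ln (real (Suc n)) + L \<epsilon> * (- ?A + 2 * e)" by (simp add: ln_mult)
      finally have "ln (?E \<epsilon>) / L \<epsilon> \<le> (ln (real (Suc n)) + L \<epsilon> * (- ?A + 2 * e)) / L \<epsilon>"
        using elim by (intro divide_right_mono) auto
      also have "\<dots> = ln (real (Suc n)) / L \<epsilon> + (- ?A + 2 * e)" using elim by (simp add: add_divide_distrib)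
      also have "\<dots> < e + (- ?A + 2 * e)" using elim by simp
      also have "\<dots> = u" by (simp add: e_def field_simps)
      finally show ?case .
    qed
  qed
qed

text \<open>Each \<open>r j\<close> is eventually a small fraction of \<open>p\<close>, so \<open>q\<close> is at least \<open>p / 2\<close>.\<close>

lemma log_rate_negligible:
  fixes p q L :: "'b \<Rightarrow> real" and r :: "'i \<Rightarrow> 'b \<Rightarrow> real"
  assumes J: "finite J" and L: "filterlim L at_top F"
    and p: "((\<lambda>\<epsilon>. ln (p \<epsilon>) / L \<epsilon>) \<longlongrightarrow> - V) F" "\<forall>\<^sub>F \<epsilon> in F. 0 < p \<epsilon>"
    and r: "\<And>j. j \<in> J \<Longrightarrow> ((\<lambda>\<epsilon>. ln (r j \<epsilon>) / L \<epsilon>) \<longlongrightarrow> - W j) F" "\<And>j. j \<in> J \<Longrightarrow> \<forall>\<^sub>F \<epsilon> in F. 0 < r j \<epsilon>"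
    and W: "\<And>j. j \<in> J \<Longrightarrow> V < W j"
    and q: "\<forall>\<^sub>F \<epsilon> in F. q \<epsilon> \<le> p \<epsilon>" "\<forall>\<^sub>F \<epsilon> in F. p \<epsilon> \<le> q \<epsilon> + (\<Sum>j\<in>J. r j \<epsilon>)"
  shows "((\<lambda>\<epsilon>. ln (q \<epsilon>) / L \<epsilon>) \<longlongrightarrow> - V) F"
proof -
  have Lpos: "\<forall>\<^sub>F \<epsilon> in F. 0 < L \<epsilon>" using L by (simp add: filterlim_at_top_dense)
  define N where "N = 2 * (real (card J) + 1)"
  have N: "0 < N" by (simp add: N_def)
  have "\<forall>\<^sub>F \<epsilon> in F. \<forall>j\<in>J. r j \<epsilon> \<le> p \<epsilon> / N"
  proof (intro eventually_ball_finite J ballI)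
    fix j assume j: "j \<in> J"
    have "((\<lambda>\<epsilon>. ln (r j \<epsilon>) / L \<epsilon> - ln (p \<epsilon>) / L \<epsilon> + ln N / L \<epsilon>) \<longlongrightarrow> - W j - - V + 0) F"
      by (intro tendsto_intros r p j tendsto_divide_0[OF tendsto_const filterlim_at_top_imp_at_infinity[OF L]])
    from order_tendstoD(2)[OF this, of 0] W[OF j] have "\<forall>\<^sub>F \<epsilon> in F. ln (r j \<epsilon>) / L \<epsilon> - ln (p \<epsilon>) / L \<epsilon> + ln N / L \<epsilon> < 0" by simp
    with Lpos p(2) r(2)[OF j] show "\<forall>\<^sub>F \<epsilon> in F. r j \<epsilon> \<le> p \<epsilon> / N"
    proof eventually_elim
      case (elim \<epsilon>)
      then have "(ln (r j \<epsilon>) - ln (p \<epsilon>) + ln N) / L \<epsilon> < 0" by (simp add: add_divide_distrib diff_divide_distrib)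
      then have "ln (r j \<epsilon>) < ln (p \<epsilon>) - ln N" using elim by (simp add: divide_less_0_iff)
      also have "\<dots> = ln (p \<epsilon> / N)" using elim N by (simp add: ln_div)
      finally have "r j \<epsilon> < p \<epsilon> / N" using elim N by (subst (asm) ln_less_cancel_iff) auto
      then show ?case by simp
    qed
  qed
  with p(2) q(2) have half: "\<forall>\<^sub>F \<epsilon> in F. p \<epsilon> / 2 \<le> q \<epsilon>"
  proof eventually_elim
    case (elim \<epsilon>)
    have "(\<Sum>j\<in>J. r j \<epsilon>) \<le> (\<Sum>j\<in>J. p \<epsilon> / N)" using elim by (intro sum_mono) auto
    also have "\<dots> = real (card J) * p \<epsilon> / N" by simp
    also have "\<dots> \<le> p \<epsilon> / 2" using elim by (simp add: N_def field_simps)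
    finally show ?case using elim by linarith
  qed
  have "((\<lambda>\<epsilon>. ln (p \<epsilon>) / L \<epsilon> - ln 2 / L \<epsilon>) \<longlongrightarrow> - V - 0) F"
    by (intro tendsto_intros p tendsto_divide_0[OF tendsto_const filterlim_at_top_imp_at_infinity[OF L]])
  then have lo: "((\<lambda>\<epsilon>. ln (p \<epsilon>) / L \<epsilon> - ln 2 / L \<epsilon>) \<longlongrightarrow> - V) F" by simp
  show ?thesis
  proof (rule tendsto_sandwich[OF _ _ lo p(1)])
    show "\<forall>\<^sub>F \<epsilon> in F. ln (q \<epsilon>) / L \<epsilon> \<le> ln (p \<epsilon>) / L \<epsilon>"
      using Lpos p(2) q(1) half
    proof eventually_elim
      case (elim \<epsilon>)
      then show ?case by (intro divide_right_mono) auto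
    qed
    show "\<forall>\<^sub>F \<epsilon> in F. ln (p \<epsilon>) / L \<epsilon> - ln 2 / L \<epsilon> \<le> ln (q \<epsilon>) / L \<epsilon>"
      using Lpos p(2) q(1) half
    proof eventually_elim
      case (elim \<epsilon>)
      then have "ln (p \<epsilon> / 2) \<le> ln (q \<epsilon>)" by (subst ln_le_cancel_iff) auto
      then have "ln (p \<epsilon>) - ln 2 \<le> ln (q \<epsilon>)" using elim by (simp add: ln_div)
      then show ?case using elim by (simp add: diff_divide_distrib[symmetric] divide_right_mono)
    qed
  qed
qed

text \<open>The reciprocal of the normalisation in the theorem.\<close>

definition speed :: "real \<Rightarrow> real \<Rightarrow> real \<Rightarrow> real" where
  "speed \<alpha> \<beta> \<epsilon> = \<epsilon> powr (- (2 * \<alpha> / (1 + \<alpha>))) * \<bar>ln \<epsilon>\<bar> powr (- (\<beta> / (1 + \<alpha>)))"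

lemma powr_times_ln_powr_at_right_0:
  fixes p q :: real
  assumes "0 < p"
  shows "((\<lambda>\<epsilon>. \<epsilon> powr p * \<bar>ln \<epsilon>\<bar> powr q) \<longlongrightarrow> 0) (at_right 0)"
    and "filterlim (\<lambda>\<epsilon>. \<epsilon> powr (- p) * \<bar>ln \<epsilon>\<bar> powr q) at_top (at_right 0)"
  using assms by real_asymp+

lemma ln_quotient_at_right_0:
  fixes a c d :: real
  shows "((\<lambda>\<epsilon>. (a + c * ln \<epsilon> + d * ln \<bar>ln \<epsilon>\<bar>) / ln \<epsilon>) \<longlongrightarrow> c) (at_right 0)"
  by real_asymp

lemma speed_at_top: "0 < \<alpha> \<Longrightarrow> filterlim (speed \<alpha> \<beta>) at_top (at_right 0)"
  unfolding speed_def by (rule powr_times_ln_powr_at_right_0(2)) simp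

lemma eventually_small_arg: "\<forall>\<^sub>F \<epsilon> in at_right (0::real). 0 < \<epsilon> \<and> \<epsilon> < 1"
  using eventually_at_right_real[of 0 1] by (auto elim: eventually_mono)

text \<open>At \<open>s = y \<epsilon>\<^sup>2 L(\<epsilon>)\<close>, where \<open>L\<close> is the speed, \<open>s\<close> is a power \<open>\<epsilon>\<^bsup>2/(1+\<alpha>)\<^esup>\<close> up to logarithms.  Hence \<open>ln s \<sim> 2 / (1 + \<alpha>) ln \<epsilon>\<close>, and
  the constant is corrected by this ratio, raised to the power \<open>- \<beta>\<close>, and by the factor \<open>y\<^sup>-\<^sup>\<alpha>\<close>.\<close>

lemma log_rate_rescale:
  fixes P :: "real \<Rightarrow> real"
  assumes \<alpha>: "0 < \<alpha>" and y: "0 < y"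
    and rate: "((\<lambda>s. s powr \<alpha> * \<bar>ln s\<bar> powr \<beta> * ln (P s)) \<longlongrightarrow> - \<kappa>) (at_right 0)"
  shows "((\<lambda>\<epsilon>. ln (P (y * (\<epsilon>\<^sup>2 * speed \<alpha> \<beta> \<epsilon>))) / speed \<alpha> \<beta> \<epsilon>)
    \<longlongrightarrow> - (\<kappa> * ((1 + \<alpha>) / 2) powr \<beta> * y powr (- \<alpha>))) (at_right 0)"
proof -
  define x where "x \<epsilon> = \<epsilon>\<^sup>2 * speed \<alpha> \<beta> \<epsilon>" for \<epsilon>
  have x_eq: "x \<epsilon> = \<epsilon> powr (2 / (1 + \<alpha>)) * \<bar>ln \<epsilon>\<bar> powr (- (\<beta> / (1 + \<alpha>)))" if "0 < \<epsilon>" for \<epsilon>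
  proof -
    have "2 + - (2 * \<alpha> / (1 + \<alpha>)) = 2 / (1 + \<alpha>)" using \<alpha> by (simp add: field_simps)
    then show ?thesis using that powr_add[of \<epsilon> 2 "- (2 * \<alpha> / (1 + \<alpha>))"]
      by (simp add: x_def speed_def mult.assoc powr_numeral)
  qed
  have x_pos: "\<forall>\<^sub>F \<epsilon> in at_right 0. 0 < x \<epsilon>"
    using eventually_small_arg by eventually_elim (simp add: x_eq)
  have "((\<lambda>\<epsilon>. \<epsilon> powr (2 / (1 + \<alpha>)) * \<bar>ln \<epsilon>\<bar> powr (- (\<beta> / (1 + \<alpha>)))) \<longlongrightarrow> 0) (at_right 0)"
    using \<alpha> by (intro powr_times_ln_powr_at_right_0) simp
  then have "(x \<longlongrightarrow> 0) (at_right 0)"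
    by (rule Lim_transform_eventually) (use eventually_small_arg in eventually_elim, simp add: x_eq)
  from tendsto_mult[OF tendsto_const[of y] this] have "((\<lambda>\<epsilon>. y * x \<epsilon>) \<longlongrightarrow> 0) (at_right 0)" by simp
  then have yx: "filterlim (\<lambda>\<epsilon>. y * x \<epsilon>) (at_right 0) (at_right 0)"
    using x_pos y by (auto simp: filterlim_at elim!: eventually_mono)
  have ln_x: "ln (y * x \<epsilon>) = ln y + 2 / (1 + \<alpha>) * ln \<epsilon> + - (\<beta> / (1 + \<alpha>)) * ln \<bar>ln \<epsilon>\<bar>"
    if "0 < \<epsilon>" "\<epsilon> < 1" for \<epsilon>
    using that y by (simp add: x_eq ln_mult ln_powr)
  have "((\<lambda>\<epsilon>. \<bar>(ln y + 2 / (1 + \<alpha>) * ln \<epsilon> + - (\<beta> / (1 + \<alpha>)) * ln \<bar>ln \<epsilon>\<bar>) / ln \<epsilon>\<bar>) \<longlongrightarrow> \<bar>2 / (1 + \<alpha>)\<bar>) (at_right 0)"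
    by (intro tendsto_rabs ln_quotient_at_right_0)
  then have "((\<lambda>\<epsilon>. \<bar>ln (y * x \<epsilon>) / ln \<epsilon>\<bar>) \<longlongrightarrow> 2 / (1 + \<alpha>)) (at_right 0)"
  proof (rule Lim_transform_eventually[OF _, THEN tendsto_eq_rhs])
    show "\<forall>\<^sub>F \<epsilon> in at_right 0. \<bar>(ln y + 2 / (1 + \<alpha>) * ln \<epsilon> + - (\<beta> / (1 + \<alpha>)) * ln \<bar>ln \<epsilon>\<bar>) / ln \<epsilon>\<bar> = \<bar>ln (y * x \<epsilon>) / ln \<epsilon>\<bar>"
      using eventually_small_arg by eventually_elim (simp add: ln_x)
  qed (use \<alpha> in simp)
  then have lim: "((\<lambda>\<epsilon>. y powr (- \<alpha>) * \<bar>ln (y * x \<epsilon>) / ln \<epsilon>\<bar> powr (- \<beta>)) \<longlongrightarrow> y powr (- \<alpha>) * (2 / (1 + \<alpha>)) powr (- \<beta>)) (at_right 0)"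
    using \<alpha> by (intro tendsto_intros) auto
  have "((\<lambda>\<epsilon>. (y * x \<epsilon>) powr \<alpha> * \<bar>ln (y * x \<epsilon>)\<bar> powr \<beta> * ln (P (y * x \<epsilon>))) \<longlongrightarrow> - \<kappa>) (at_right 0)"
    using filterlim_compose[OF rate yx] .
  from tendsto_mult[OF this lim]
  have "((\<lambda>\<epsilon>. (y * x \<epsilon>) powr \<alpha> * \<bar>ln (y * x \<epsilon>)\<bar> powr \<beta> * ln (P (y * x \<epsilon>)) * (y powr (- \<alpha>) * \<bar>ln (y * x \<epsilon>) / ln \<epsilon>\<bar> powr (- \<beta>)))
     \<longlongrightarrow> - \<kappa> * (y powr (- \<alpha>) * (2 / (1 + \<alpha>)) powr (- \<beta>))) (at_right 0)" .
  then have "((\<lambda>\<epsilon>. ln (P (y * x \<epsilon>)) / speed \<alpha> \<beta> \<epsilon>) \<longlongrightarrow> - \<kappa> * (y powr (- \<alpha>) * (2 / (1 + \<alpha>)) powr (- \<beta>))) (at_right 0)"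
  proof (rule Lim_transform_eventually)
    have "filterlim (\<lambda>\<epsilon>. ln (y * x \<epsilon>)) at_bot (at_right 0)"
      by (rule filterlim_compose[OF ln_at_0 yx])
    then have "\<forall>\<^sub>F \<epsilon> in at_right 0. ln (y * x \<epsilon>) < 0" by (simp add: filterlim_at_bot_dense)
    with eventually_small_arg x_pos
    show "\<forall>\<^sub>F \<epsilon> in at_right 0. (y * x \<epsilon>) powr \<alpha> * \<bar>ln (y * x \<epsilon>)\<bar> powr \<beta> * ln (P (y * x \<epsilon>)) * (y powr (- \<alpha>) * \<bar>ln (y * x \<epsilon>) / ln \<epsilon>\<bar> powr (- \<beta>))
       = ln (P (y * x \<epsilon>)) / speed \<alpha> \<beta> \<epsilon>"
    proof eventually_elim
      case (elim \<epsilon>)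
      let ?l = "\<bar>ln \<epsilon>\<bar>" and ?s = "\<bar>ln (y * x \<epsilon>)\<bar>"
      have l: "0 < ?l" "0 < ?s" using elim by auto
      have m0: "x \<epsilon> powr \<alpha> * ?l powr \<beta> = 1 / speed \<alpha> \<beta> \<epsilon>"
      proof -
        have "x \<epsilon> powr \<alpha> = \<epsilon> powr (2 / (1 + \<alpha>) * \<alpha>) * ?l powr (- (\<beta> / (1 + \<alpha>)) * \<alpha>)"
          using elim by (simp add: x_eq powr_mult powr_powr)
        moreover have "?l powr (- (\<beta> / (1 + \<alpha>)) * \<alpha>) * ?l powr \<beta> = ?l powr (\<beta> / (1 + \<alpha>))"
        proof -
          have "- (\<beta> / (1 + \<alpha>)) * \<alpha> + \<beta> = \<beta> / (1 + \<alpha>)" using \<alpha> by (simp add: field_simps)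
          then show ?thesis by (simp add: powr_add[symmetric])
        qed
        moreover have "2 / (1 + \<alpha>) * \<alpha> = 2 * \<alpha> / (1 + \<alpha>)" by simp
        ultimately have "x \<epsilon> powr \<alpha> * ?l powr \<beta> = \<epsilon> powr (2 * \<alpha> / (1 + \<alpha>)) * ?l powr (\<beta> / (1 + \<alpha>))"
          by (simp add: mult.assoc)
        then show ?thesis by (simp add: speed_def powr_minus divide_inverse)
      qed
      have m1: "(y * x \<epsilon>) powr \<alpha> = y powr \<alpha> * x \<epsilon> powr \<alpha>" using y elim by (simp add: powr_mult)
      have m2: "\<bar>ln (y * x \<epsilon>) / ln \<epsilon>\<bar> powr (- \<beta>) = ?s powr (- \<beta>) * ?l powr \<beta>"
        using l by (simp add: powr_divide powr_minus field_simps)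
      have m3: "y powr \<alpha> * y powr (- \<alpha>) = 1" "?s powr \<beta> * ?s powr (- \<beta>) = 1"
        using y l by (simp_all add: powr_minus)
      have "(y * x \<epsilon>) powr \<alpha> * ?s powr \<beta> * ln (P (y * x \<epsilon>)) * (y powr (- \<alpha>) * \<bar>ln (y * x \<epsilon>) / ln \<epsilon>\<bar> powr (- \<beta>))
        = (y powr \<alpha> * y powr (- \<alpha>)) * (?s powr \<beta> * ?s powr (- \<beta>)) * (x \<epsilon> powr \<alpha> * ?l powr \<beta>) * ln (P (y * x \<epsilon>))"
        unfolding m1 m2 by (simp only: mult_ac)
      then show ?case unfolding m0 m3 by simp
    qed
  qed
  moreover have "(2 / (1 + \<alpha>)) powr (- \<beta>) = ((1 + \<alpha>) / 2) powr \<beta>"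
    using \<alpha> by (simp add: powr_minus powr_divide)
  ultimately show ?thesis by (simp add: x_def mult_ac)
qed

section \<open>Small values of the running maximum\<close>

definition small_max_rate :: "real \<Rightarrow> real \<Rightarrow> (real \<Rightarrow> real \<Rightarrow> real) \<Rightarrow> nat \<Rightarrow> (nat \<Rightarrow> real) \<Rightarrow> (nat \<Rightarrow> real) \<Rightarrow> real" where
  "small_max_rate \<alpha> \<beta> K m t b = 2 powr (- \<beta> / (1 + \<alpha>)) * (1 + \<alpha>) powr (1 + \<beta> / (1 + \<alpha>))
     * (pi\<^sup>2 / (8 * \<alpha>)) powr (\<alpha> / (1 + \<alpha>))
     * (\<Sum>i=1..m. (K (t (i - 1)) (t i) / b i powr (2 * \<alpha>)) powr (1 / (1 + \<alpha>)))"

lemma laplace_exponent_eq_small_max_rate: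
  assumes \<alpha>: "0 < \<alpha>" and b: "\<And>i. i \<in> {1..m} \<Longrightarrow> 0 < b i"
    and S: "S = (\<Sum>i=1..m. ((1 / (b i)\<^sup>2) powr \<alpha> * K (t (i - 1)) (t i)) powr (1 / (1 + \<alpha>)))" and "0 < S"
  shows "laplace_exponent \<alpha> (S powr (1 + \<alpha>) * ((1 + \<alpha>) / 2) powr \<beta>) (pi\<^sup>2 / 8) = small_max_rate \<alpha> \<beta> K m t b"
proof -
  have S': "S = (\<Sum>i=1..m. (K (t (i - 1)) (t i) / b i powr (2 * \<alpha>)) powr (1 / (1 + \<alpha>)))"
    unfolding S
  proof (intro sum.cong HOL.refl)
    fix i assume "i \<in> {1..m}"
    then have "0 < b i" by (rule b)
    then have "(1 / (b i)\<^sup>2) powr \<alpha> = 1 / b i powr (2 * \<alpha>)"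
      by (simp add: powr_divide powr_powr powr_numeral[symmetric] del: powr_numeral)
    then show "((1 / (b i)\<^sup>2) powr \<alpha> * K (t (i - 1)) (t i)) powr (1 / (1 + \<alpha>))
      = (K (t (i - 1)) (t i) / b i powr (2 * \<alpha>)) powr (1 / (1 + \<alpha>))" by simp
  qed
  have "(S powr (1 + \<alpha>) * ((1 + \<alpha>) / 2) powr \<beta>) powr (1 / (1 + \<alpha>)) = S * ((1 + \<alpha>) / 2) powr (\<beta> / (1 + \<alpha>))"
    using \<alpha> \<open>0 < S\<close> by (simp add: powr_mult powr_powr)
  also have "((1 + \<alpha>) / 2) powr (\<beta> / (1 + \<alpha>)) = (1 + \<alpha>) powr (\<beta> / (1 + \<alpha>)) * 2 powr (- \<beta> / (1 + \<alpha>))"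
    using \<alpha> by (simp add: powr_divide powr_minus_divide)
  finally have k: "(S powr (1 + \<alpha>) * ((1 + \<alpha>) / 2) powr \<beta>) powr (1 / (1 + \<alpha>))
    = S * ((1 + \<alpha>) powr (\<beta> / (1 + \<alpha>)) * 2 powr (- \<beta> / (1 + \<alpha>)))" .
  have pi: "(pi\<^sup>2 / (8 * \<alpha>)) powr (\<alpha> / (1 + \<alpha>)) = \<alpha> powr (- \<alpha> / (1 + \<alpha>)) * (pi\<^sup>2 / 8) powr (\<alpha> / (1 + \<alpha>))"
  proof -
    have "pi\<^sup>2 / (8 * \<alpha>) = (pi\<^sup>2 / 8) / \<alpha>" by simp
    then show ?thesis using \<alpha> by (simp only: powr_divide) (simp add: powr_minus_divide)
  qed
  have one: "(1 + \<alpha>) powr (1 + \<beta> / (1 + \<alpha>)) = (1 + \<alpha>) * (1 + \<alpha>) powr (\<beta> / (1 + \<alpha>))"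
    using \<alpha> by (simp add: powr_add)
  show ?thesis
    unfolding small_max_rate_def laplace_exponent_def k S'[symmetric] pi one by (simp only: mult_ac)
qed

context prob_space begin

lemma clock_weight_sum_pos:
  assumes "clock_assumption C \<alpha> \<beta> K" and m: "1 \<le> m"
    and t: "t 0 = 0" "\<And>i. i < m \<Longrightarrow> t i < t (Suc i)" and d: "\<And>i. i \<in> {1..m} \<Longrightarrow> 0 < d i"
  shows "0 < (\<Sum>i=1..m. (d i powr \<alpha> * K (t (i - 1)) (t i)) powr (1 / (1 + \<alpha>)))"
proof (rule sum_pos)
  fix i assume i: "i \<in> {1..m}"
  have "0 \<le> t (i - 1)" using i by (intro times_nonneg[OF t]) auto
  moreover have "t (i - 1) < t i" using t(2)[of "i - 1"] i by (cases i) auto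
  ultimately have "0 < K (t (i - 1)) (t i)" using assms(1) by (simp add: clock_assumption_def)
  then show "0 < (d i powr \<alpha> * K (t (i - 1)) (t i)) powr (1 / (1 + \<alpha>))" using d[OF i] by simp
qed (use m in auto)

text \<open>The lower Laplace bound has the right exponent \<open>\<pi>\<^sup>2 / 8\<close>.  The upper one has it only up to the factor \<open>(1 - \<eta>)\<^sup>2\<close>, which
  disappears as \<open>\<eta> \<rightarrow> 0\<close> because the Laplace exponent is continuous in \<open>\<gamma>\<close>.\<close>

theorem small_max_event_log_rate:
  assumes bm: "standard_brownian_motion B" and clock: "clock_assumption C \<alpha> \<beta> K"
    and indep: "independent_processes B C" and m: "1 \<le> m"
    and t: "t 0 = 0" "\<And>i. i < m \<Longrightarrow> t i < t (Suc i)"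
    and b: "0 < b 1" "\<And>i. 1 \<le> i \<Longrightarrow> i < m \<Longrightarrow> b i < b (Suc i)"
  shows "((\<lambda>\<epsilon>. ln (prob (small_max_event B C m t (\<lambda>i. b i * \<epsilon>))) / speed \<alpha> \<beta> \<epsilon>)
    \<longlongrightarrow> - small_max_rate \<alpha> \<beta> K m t b) (at_right 0)"
    and "0 < small_max_rate \<alpha> \<beta> K m t b"
proof -
  have \<alpha>: "0 < \<alpha>" and cp: "clock_process C" using clock by (simp_all add: clock_assumption_def)
  have b_pos: "0 < b i" if "i \<in> {1..m}" for i
  proof -
    have "b 1 \<le> b i" by (rule mono_upto[of 1 m b]) (use b(2) that in \<open>auto intro: less_imp_le\<close>)
    then show ?thesis using b(1) by simp
  qed
  define d where "d i = 1 / (b i)\<^sup>2" for i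
  have d_pos: "0 < d i" if "i \<in> {1..m}" for i using b_pos[OF that] by (simp add: d_def)
  define X where "X = weighted_clock C m t d"
  define S where "S = (\<Sum>i=1..m. (d i powr \<alpha> * K (t (i - 1)) (t i)) powr (1 / (1 + \<alpha>)))"
  have S_pos: "0 < S" unfolding S_def by (rule clock_weight_sum_pos[OF clock m t d_pos])
  define k where "k = S powr (1 + \<alpha>) * ((1 + \<alpha>) / 2) powr \<beta>"
  have k: "0 < k" using S_pos \<alpha> by (simp add: k_def)
  let ?L = "speed \<alpha> \<beta>" and ?V = "small_max_rate \<alpha> \<beta> K m t b"
  let ?p = "\<lambda>\<epsilon>. prob (small_max_event B C m t (\<lambda>i. b i * \<epsilon>))"
  have V: "laplace_exponent \<alpha> k (pi\<^sup>2 / 8) = ?V"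
    unfolding k_def by (rule laplace_exponent_eq_small_max_rate[OF \<alpha> b_pos _ S_pos]) (simp_all add: S_def d_def)
  show V_pos: "0 < ?V" unfolding V[symmetric] by (rule laplace_exponent_pos[OF \<alpha> k]) simp
  have X_meas: "X \<in> borel_measurable M"
    unfolding X_def by (rule borel_measurable_weighted_clock[OF cp t])
  have X_nonneg: "0 \<le> X \<omega>" if "\<omega> \<in> space M" for \<omega>
    unfolding X_def by (rule weighted_clock_nonneg[OF cp t that]) (use d_pos in \<open>auto intro: less_imp_le\<close>)
  have "((\<lambda>s. s powr \<alpha> * \<bar>ln s\<bar> powr \<beta> * ln (prob {\<omega>\<in>space M. X \<omega> \<le> s})) \<longlongrightarrow> - (S powr (1 + \<alpha>))) (at_right 0)"
  proof -
    have "d (Suc i) < d i" if "i \<in> {1..<m}" for i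
      using b_pos[of i] b_pos[of "Suc i"] b(2)[of i] that
      by (auto simp: d_def intro!: divide_strict_left_mono power_strict_mono)
    then show ?thesis
      using clock m t d_pos unfolding clock_assumption_def X_def weighted_clock_def S_def by blast
  qed
  note rate = log_rate_rescale[OF \<alpha> _ this]
  have x_pos: "\<forall>\<^sub>F \<epsilon> in at_right 0. 0 < \<epsilon>\<^sup>2 * ?L \<epsilon>"
    using eventually_small_arg by eventually_elim (simp add: speed_def)
  have laplace: "((\<lambda>\<epsilon>. ln (expectation (\<lambda>\<omega>. exp (- \<gamma> * (?L \<epsilon> / (\<epsilon>\<^sup>2 * ?L \<epsilon>)) * X \<omega>))) / ?L \<epsilon>) \<longlongrightarrow> - laplace_exponent \<alpha> k \<gamma>) (at_right 0)"
    if "0 < \<gamma>" for \<gamma>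
    by (rule laplace_transform_log_rate[OF X_meas X_nonneg \<alpha> k that speed_at_top[OF \<alpha>] x_pos])
      (simp_all add: k_def rate[unfolded mult.assoc] mult.assoc)
  have L_pos: "\<forall>\<^sub>F \<epsilon> in at_right 0. 0 < ?L \<epsilon>"
    using eventually_small_arg by eventually_elim (simp add: speed_def)
  have scale: "exp (- \<gamma> * (?L \<epsilon> / (\<epsilon>\<^sup>2 * ?L \<epsilon>)) * X \<omega>) = exp (- \<gamma> * weighted_clock C m t (\<lambda>i. 1 / (b i * \<epsilon>)\<^sup>2) \<omega>)"
    if "0 < ?L \<epsilon>" for \<gamma> \<epsilon> \<omega>
  proof -
    have "weighted_clock C m t (\<lambda>i. 1 / (b i * \<epsilon>)\<^sup>2) \<omega> = 1 / \<epsilon>\<^sup>2 * X \<omega>"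
      unfolding X_def weighted_clock_def d_def sum_distrib_left
      by (intro sum.cong HOL.refl) (simp add: power_mult_distrib)
    then show ?thesis using that by simp
  qed
  have scaled_b: "0 < b 1 * \<epsilon>" "\<And>i. 1 \<le> i \<Longrightarrow> i < m \<Longrightarrow> b i * \<epsilon> \<le> b (Suc i) * \<epsilon>" if "0 < \<epsilon>" for \<epsilon>
    using b that by (auto intro!: mult_right_mono less_imp_le)
  have E_pos: "\<forall>\<^sub>F \<epsilon> in at_right 0. 0 < expectation (\<lambda>\<omega>. exp (- \<gamma> * (?L \<epsilon> / (\<epsilon>\<^sup>2 * ?L \<epsilon>)) * X \<omega>))" if "0 < \<gamma>" for \<gamma>
    by (rule eventually_pos_of_log_rate[OF laplace[OF that] laplace_exponent_pos[OF \<alpha> k that]]) simp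
  have pi8: "0 < pi\<^sup>2 / 8" by simp
  have lower: "\<forall>\<^sub>F \<epsilon> in at_right 0. 0 < ?p \<epsilon> \<and>
     ln (expectation (\<lambda>\<omega>. exp (- (pi\<^sup>2 / 8) * (?L \<epsilon> / (\<epsilon>\<^sup>2 * ?L \<epsilon>)) * X \<omega>))) / ?L \<epsilon> \<le> ln (?p \<epsilon>) / ?L \<epsilon>"
    using eventually_small_arg L_pos E_pos[OF pi8]
  proof eventually_elim
    case (elim \<epsilon>)
    let ?E = "expectation (\<lambda>\<omega>. exp (- (pi\<^sup>2 / 8) * (?L \<epsilon> / (\<epsilon>\<^sup>2 * ?L \<epsilon>)) * X \<omega>))"
    have E: "0 < ?E" by (rule elim(3))
    have "?E \<le> ?p \<epsilon>" unfolding scale[OF elim(2)]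
      by (rule small_max_event_lower[where t=t and m=m, OF bm cp indep m t scaled_b]) (use elim in auto)
    with E elim show ?case by (auto intro!: divide_right_mono)
  qed
  show "((\<lambda>\<epsilon>. ln (?p \<epsilon>) / ?L \<epsilon>) \<longlongrightarrow> - ?V) (at_right 0)"
  proof (rule order_tendstoI)
    fix l assume "l < - ?V"
    with order_tendstoD(1)[OF laplace[of "pi\<^sup>2 / 8"], of l]
    have "\<forall>\<^sub>F \<epsilon> in at_right 0. l < ln (expectation (\<lambda>\<omega>. exp (- (pi\<^sup>2 / 8) * (?L \<epsilon> / (\<epsilon>\<^sup>2 * ?L \<epsilon>)) * X \<omega>))) / ?L \<epsilon>"
      unfolding V by simp
    with lower show "\<forall>\<^sub>F \<epsilon> in at_right 0. l < ln (?p \<epsilon>) / ?L \<epsilon>" by eventually_elim linarith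
  next
    fix u assume u: "- ?V < u"
    have "((\<lambda>\<eta>. - laplace_exponent \<alpha> k ((1 - \<eta>)\<^sup>2 * (pi\<^sup>2 / 8))) \<longlongrightarrow> - laplace_exponent \<alpha> k ((1 - 0)\<^sup>2 * (pi\<^sup>2 / 8))) (at_right 0)"
      unfolding laplace_exponent_def by (intro tendsto_intros) auto
    then have "\<forall>\<^sub>F \<eta> in at_right 0. - laplace_exponent \<alpha> k ((1 - \<eta>)\<^sup>2 * (pi\<^sup>2 / 8)) < u"
      using V u by (intro order_tendstoD(2)) auto
    with eventually_small_arg have "\<forall>\<^sub>F \<eta> in at_right 0. 0 < \<eta> \<and> \<eta> < 1 \<and> - laplace_exponent \<alpha> k ((1 - \<eta>)\<^sup>2 * (pi\<^sup>2 / 8)) < u"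
      by eventually_elim auto
    then obtain \<eta> :: real where \<eta>: "0 < \<eta>" "\<eta> < 1" and less: "- laplace_exponent \<alpha> k ((1 - \<eta>)\<^sup>2 * (pi\<^sup>2 / 8)) < u"
      using eventually_happens'[OF trivial_limit_at_right_real] by blast
    let ?\<gamma> = "(1 - \<eta>)\<^sup>2 * (pi\<^sup>2 / 8)"
    let ?E = "\<lambda>\<epsilon>. expectation (\<lambda>\<omega>. exp (- ?\<gamma> * (?L \<epsilon> / (\<epsilon>\<^sup>2 * ?L \<epsilon>)) * X \<omega>))"
    define \<kappa> where "\<kappa> = (1 / cos ((1 - \<eta>) * (pi / 2))) ^ m"
    have \<gamma>: "0 < ?\<gamma>" using \<eta> by simp
    have "0 < cos ((1 - \<eta>) * (pi / 2))"
    proof (rule cos_gt_zero)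
      show "(1 - \<eta>) * (pi / 2) < pi / 2" "0 < (1 - \<eta>) * (pi / 2)" using \<eta> by auto
    qed
    then have \<kappa>: "0 < \<kappa>" by (simp add: \<kappa>_def)
    have "((\<lambda>\<epsilon>. ln \<kappa> / ?L \<epsilon> + ln (?E \<epsilon>) / ?L \<epsilon>) \<longlongrightarrow> 0 + - laplace_exponent \<alpha> k ?\<gamma>) (at_right 0)"
      by (intro tendsto_add laplace[OF \<gamma>] tendsto_divide_0[OF tendsto_const filterlim_at_top_imp_at_infinity[OF speed_at_top[OF \<alpha>]]])
    from order_tendstoD(2)[OF this, of u] less
    have "\<forall>\<^sub>F \<epsilon> in at_right 0. ln \<kappa> / ?L \<epsilon> + ln (?E \<epsilon>) / ?L \<epsilon> < u" by simp
    with eventually_small_arg L_pos lower E_pos[OF \<gamma>]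
    show "\<forall>\<^sub>F \<epsilon> in at_right 0. ln (?p \<epsilon>) / ?L \<epsilon> < u"
    proof eventually_elim
      case (elim \<epsilon>)
      have "?p \<epsilon> \<le> \<kappa> * ?E \<epsilon>" unfolding scale[OF elim(2)] \<kappa>_def
        by (rule small_max_event_upper[where t=t and m=m, OF bm cp indep m t scaled_b \<eta>]) (use elim in auto)
      then have "ln (?p \<epsilon>) \<le> ln (\<kappa> * ?E \<epsilon>)" using elim \<kappa> by (subst ln_le_cancel_iff) auto
      also have "\<dots> = ln \<kappa> + ln (?E \<epsilon>)" by (rule ln_mult_pos[OF \<kappa> elim(4)])
      finally have "ln (?p \<epsilon>) / ?L \<epsilon> \<le> (ln \<kappa> + ln (?E \<epsilon>)) / ?L \<epsilon>"
        using elim(2) by (intro divide_right_mono) auto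
      also have "\<dots> = ln \<kappa> / ?L \<epsilon> + ln (?E \<epsilon>) / ?L \<epsilon>" by (rule add_divide_distrib)
      also have "\<dots> < u" by (rule elim(5))
      finally show ?case .
    qed
  qed
qed

end

lemma small_max_rate_strict_antimono:
  assumes \<alpha>: "0 < \<alpha>" and j: "j \<in> {1..m}"
    and K: "\<And>i. i \<in> {1..m} \<Longrightarrow> 0 < K (t (i - 1)) (t i)" and b: "0 < c" "c < b j"
  shows "small_max_rate \<alpha> \<beta> K m t b < small_max_rate \<alpha> \<beta> K m t (b(j := c))"
  unfolding small_max_rate_def
proof (rule mult_strict_left_mono)
  let ?f = "\<lambda>b i. (K (t (i - 1)) (t i) / b i powr (2 * \<alpha>)) powr (1 / (1 + \<alpha>))"
  have "c powr (2 * \<alpha>) < b j powr (2 * \<alpha>)" using \<alpha> b by (intro powr_less_mono2) auto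
  then have "K (t (j - 1)) (t j) / b j powr (2 * \<alpha>) < K (t (j - 1)) (t j) / c powr (2 * \<alpha>)"
    using K[OF j] b by (intro divide_strict_left_mono) auto
  then have "?f b j < ?f (b(j := c)) j"
    using \<alpha> K[OF j] b by (auto intro!: powr_less_mono2)
  then show "(\<Sum>i=1..m. ?f b i) < (\<Sum>i=1..m. ?f (b(j := c)) i)"
    using j by (intro sum_strict_mono_ex1) (auto simp: fun_upd_def)
  show "0 < 2 powr (- \<beta> / (1 + \<alpha>)) * (1 + \<alpha>) powr (1 + \<beta> / (1 + \<alpha>)) * (pi\<^sup>2 / (8 * \<alpha>)) powr (\<alpha> / (1 + \<alpha>))"
    using \<alpha> by simp
qed

theorem theorem1p3:
  fixes P :: "'a measure" and B C Z :: "real \<Rightarrow> 'a \<Rightarrow> real"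
    and \<alpha> \<beta> :: real and K :: "real \<Rightarrow> real \<Rightarrow> real"
    and m :: nat and t a b :: "nat \<Rightarrow> real"
  assumes "prob_space P"
    and "prob_space.clock_assumption P C \<alpha> \<beta> K"
    and "prob_space.standard_brownian_motion P B"
    and "prob_space.independent_processes P B C"
    and "Z = time_changed B C"
    and "m \<ge> 1"
    and "t 0 = 0" and "\<forall>i<m. t i < t (Suc i)"
    and "0 \<le> a 1" and "\<forall>i\<in>{1..m}. a i < b i" and "\<forall>i\<in>{1..<m}. b i \<le> a (Suc i)"
  shows "((\<lambda>\<epsilon>. \<epsilon> powr (2 * \<alpha> / (1 + \<alpha>)) * \<bar>ln \<epsilon>\<bar> powr (\<beta> / (1 + \<alpha>)) *
             ln (measure P (\<Inter>i\<in>{1..m}. {\<omega>\<in>space P.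
                   a i * \<epsilon> \<le> running_max Z (t i) \<omega> \<and> running_max Z (t i) \<omega> \<le> b i * \<epsilon>})))
          \<longlongrightarrow>
          - (2 powr (- \<beta> / (1 + \<alpha>)) * (1 + \<alpha>) powr (1 + \<beta> / (1 + \<alpha>))
             * (pi\<^sup>2 / (8 * \<alpha>)) powr (\<alpha> / (1 + \<alpha>))
             * (\<Sum>i=1..m. (K (t (i - 1)) (t i) / b i powr (2 * \<alpha>)) powr (1 / (1 + \<alpha>)))))
         (at_right 0)"
proof -
  interpret prob_space P by fact
  note clock = assms(2) and bm = assms(3) and indep = assms(4) and Z = assms(5) and m = assms(6)
  have \<alpha>: "0 < \<alpha>" and cp: "clock_process C" using clock by (simp_all add: clock_assumption_def)
  have t: "t 0 = 0" "\<And>i. i < m \<Longrightarrow> t i < t (Suc i)" using assms(7,8) by auto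
  have t_nonneg: "0 \<le> t i" if "i \<le> m" for i
    by (rule times_nonneg[OF t that])
  have ab: "a i < b i" if "i \<in> {1..m}" for i using assms(10) that by blast
  have ba: "b i \<le> a (Suc i)" if "1 \<le> i" "i < m" for i using assms(11) that by simp
  have b: "0 < b 1" "\<And>i. 1 \<le> i \<Longrightarrow> i < m \<Longrightarrow> b i < b (Suc i)"
  proof -
    show "0 < b 1" using ab[of 1] assms(9) m by simp
    show "b i < b (Suc i)" if "1 \<le> i" "i < m" for i
      using ba[OF that] ab[of "Suc i"] that by simp
  qed
  have b_pos: "0 < b i" if "i \<in> {1..m}" for i
  proof -
    have "b 1 \<le> b i" by (rule mono_upto[of 1 m b]) (use b(2) that in \<open>auto intro: less_imp_le\<close>)
    then show ?thesis using b(1) by simp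
  qed
  have a_nonneg: "0 \<le> a i" if "i \<in> {1..m}" for i
  proof (cases "i = 1")
    case False
    then have "1 \<le> i - 1" "i - 1 < m" "Suc (i - 1) = i" using that by auto
    then show ?thesis using ba[of "i - 1"] b_pos[of "i - 1"] by simp
  qed (use assms(9) in simp)
  \<comment> \<open>The midpoint lies strictly above \<open>b (i - 1)\<close>, even if \<open>a i = b (i - 1)\<close>, so \<open>b(i := c i)\<close> is strictly increasing;
    for \<open>i = 1\<close> it is positive even if \<open>a 1 = 0\<close>.\<close>
  define c where "c i = (a i + b i) / 2" for i
  have c: "a i < c i" "c i < b i" if "i \<in> {1..m}" for i using ab[OF that] by (auto simp: c_def)
  let ?b = "\<lambda>j. b(j := c j)"
  have bj: "0 < ?b j 1" "\<And>i. 1 \<le> i \<Longrightarrow> i < m \<Longrightarrow> ?b j i < ?b j (Suc i)" if j: "j \<in> {1..m}" for j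
  proof -
    show "0 < ?b j 1" using b c(1)[OF j] a_nonneg[OF j] by auto
    fix i assume i: "1 \<le> i" "i < m"
    have "c i < b (Suc i)" using c(2)[of i] b(2)[OF i] i by auto
    moreover have "b i < c (Suc i)" using c(1)[of "Suc i"] ba[OF i] i by auto
    ultimately show "?b j i < ?b j (Suc i)" using b(2)[OF i] by auto
  qed
  have K_pos: "0 < K (t (i - 1)) (t i)" if "i \<in> {1..m}" for i
    using clock t_nonneg[of "i - 1"] t(2)[of "i - 1"] that by (auto simp: clock_assumption_def)
  let ?M = "\<lambda>i. running_max Z (t i)" and ?L = "speed \<alpha> \<beta>" and ?V = "small_max_rate \<alpha> \<beta> K m t"
  define Q where "Q \<epsilon> = (\<Inter>i\<in>{1..m}. {\<omega>\<in>space P. a i * \<epsilon> \<le> ?M i \<omega> \<and> ?M i \<omega> \<le> b i * \<epsilon>})" for \<epsilon>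
  let ?E = "\<lambda>b \<epsilon>. small_max_event B C m t (\<lambda>i. b i * \<epsilon>)"
  have M_meas: "?M i \<in> borel_measurable P" if "i \<le> m" for i
    unfolding Z by (rule borel_measurable_running_max[OF bm cp t_nonneg[OF that]])
  have E_def: "?E b \<epsilon> = {\<omega>\<in>space P. \<forall>i\<in>{1..m}. ?M i \<omega> \<le> b i * \<epsilon>}" for b \<epsilon>
    unfolding small_max_event_def Z ..
  have E_sets: "?E b \<epsilon> \<in> sets P" for b \<epsilon>
    by (rule small_max_event_sets[OF bm cp t_nonneg])
  have Q_alt: "Q \<epsilon> = {\<omega>\<in>space P. \<forall>i\<in>{1..m}. a i * \<epsilon> \<le> ?M i \<omega> \<and> ?M i \<omega> \<le> b i * \<epsilon>}" for \<epsilon>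
    using m by (auto simp: Q_def)
  have Q_sets: "Q \<epsilon> \<in> sets P" for \<epsilon>
    unfolding Q_alt by (intro sets.sets_Collect_finite_All sets.sets_Collect_conj)
      (use M_meas in \<open>auto intro: borel_measurable_le\<close>)
  note rate_b = small_max_event_log_rate[OF bm clock indep m t b]
  have rate_bj: "((\<lambda>\<epsilon>. ln (prob (?E (?b j) \<epsilon>)) / ?L \<epsilon>) \<longlongrightarrow> - ?V (?b j)) (at_right 0)"
    "0 < ?V (?b j)" if "j \<in> {1..m}" for j
  proof -
    note r = small_max_event_log_rate[where b="?b j" and m=m and t=t, OF bm clock indep m t bj[OF that]]
    show "((\<lambda>\<epsilon>. ln (prob (?E (?b j) \<epsilon>)) / ?L \<epsilon>) \<longlongrightarrow> - ?V (?b j)) (at_right 0)" by (rule r(1))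
    show "0 < ?V (?b j)" by (rule r(2))
  qed
  have "((\<lambda>\<epsilon>. ln (prob (Q \<epsilon>)) / ?L \<epsilon>) \<longlongrightarrow> - ?V b) (at_right 0)"
  proof (rule log_rate_negligible[where J="{1..m}" and r="\<lambda>j \<epsilon>. prob (?E (?b j) \<epsilon>)" and W="\<lambda>j. ?V (?b j)"])
    show "\<forall>\<^sub>F \<epsilon> in at_right 0. 0 < prob (?E b \<epsilon>)"
      by (rule eventually_pos_of_log_rate[OF rate_b measure_nonneg])
    show "\<forall>\<^sub>F \<epsilon> in at_right 0. 0 < prob (?E (?b j) \<epsilon>)" if "j \<in> {1..m}" for j
      by (rule eventually_pos_of_log_rate[OF rate_bj[OF that] measure_nonneg])
    show "?V b < ?V (?b j)" if "j \<in> {1..m}" for j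
      using c[OF that] a_nonneg[OF that] by (intro small_max_rate_strict_antimono[where K=K and t=t, OF \<alpha> that K_pos]) auto
    show "\<forall>\<^sub>F \<epsilon> in at_right 0. prob (Q \<epsilon>) \<le> prob (?E b \<epsilon>)"
      by (intro always_eventually allI finite_measure_mono E_sets) (auto simp: Q_alt E_def)
    show "\<forall>\<^sub>F \<epsilon> in at_right 0. prob (?E b \<epsilon>) \<le> prob (Q \<epsilon>) + (\<Sum>j\<in>{1..m}. prob (?E (?b j) \<epsilon>))"
      using eventually_small_arg
    proof eventually_elim
      case (elim \<epsilon>)
      have "?E b \<epsilon> \<subseteq> Q \<epsilon> \<union> (\<Union>j\<in>{1..m}. ?E (?b j) \<epsilon>)"
      proof
        fix \<omega> assume \<omega>: "\<omega> \<in> ?E b \<epsilon>"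
        show "\<omega> \<in> Q \<epsilon> \<union> (\<Union>j\<in>{1..m}. ?E (?b j) \<epsilon>)"
        proof (cases "\<exists>j\<in>{1..m}. ?M j \<omega> < a j * \<epsilon>")
          case True
          then obtain j where j: "j \<in> {1..m}" "?M j \<omega> < a j * \<epsilon>" by blast
          have "a j * \<epsilon> \<le> c j * \<epsilon>" using c[OF j(1)] elim by (intro mult_right_mono) auto
          then have "\<omega> \<in> ?E (?b j) \<epsilon>" using \<omega> j by (auto simp: E_def)
          then show ?thesis using j by blast
        next
          case False
          then show ?thesis using \<omega> by (auto simp: E_def Q_alt not_less)
        qed
      qed
      then have "prob (?E b \<epsilon>) \<le> prob (Q \<epsilon> \<union> (\<Union>j\<in>{1..m}. ?E (?b j) \<epsilon>))"
        by (intro finite_measure_mono sets.Un Q_sets sets.finite_UN E_sets) auto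
      also have "\<dots> \<le> prob (Q \<epsilon>) + prob (\<Union>j\<in>{1..m}. ?E (?b j) \<epsilon>)"
        by (intro measure_Un_le Q_sets sets.finite_UN E_sets) auto
      also have "\<dots> \<le> prob (Q \<epsilon>) + (\<Sum>j\<in>{1..m}. prob (?E (?b j) \<epsilon>))"
        by (intro add_left_mono measure_UNION_le E_sets) auto
      finally show ?case .
    qed
  qed (use rate_b rate_bj speed_at_top[OF \<alpha>] in auto)
  moreover have "\<epsilon> powr (2 * \<alpha> / (1 + \<alpha>)) * \<bar>ln \<epsilon>\<bar> powr (\<beta> / (1 + \<alpha>)) * ln (prob (Q \<epsilon>)) = ln (prob (Q \<epsilon>)) / ?L \<epsilon>" for \<epsilon>
    by (simp add: speed_def powr_minus divide_inverse)
  ultimately show ?thesis unfolding Q_def small_max_rate_def by simp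
qed

end
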